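(* Consider the elastoplastic system $(D,A,\prod_j[c_j^-,c_j^+],R,l(t))$ and the associated objects $d$, $P$, $\mathcal{V}$, $\mathcal{V}_{basis}$, $c(t)$, $C$, $C(t)$, $L(\alpha,j)$, $\overline{\overline L}(\alpha,j)$ described in the context, and assume that $l'(t)$ is constant, $l'(t)\equiv l'$. Let $I_0\subset\{-1,1\}\times\{1,\dots,m\}$ be such that $$\begin{pmatrix}1\\0_{m-n+1}\end{pmatrix}l'\in{\rm cone}\big(P\{\alpha e_j:(\alpha,j)\in I_0\}\big),$$ such that $I_0$ is irreducible (the same inclusion fails whenever one element is removed from $I_0$), and such that the inclusion is strict, i.e. the vector on the left does not belong to the relative boundary of the cone on the right. Case $|I_0|=d$: let $y_{*,0}$ be the unique $y\in\mathcal{V}$ with $\langle e_j,Ay\rangle=c_j^\alpha$ for all $(\alpha,j)\in I_0$, let $F=\{y_{*,0}\}$, and assume $c_j^-<\langle e_j,Ay_{*,0}\rangle<c_j^+$ for every spring index $j$ that does not occur in $I_0$. Case $|I_0|<d$: let $I_1\subset\{-1,1\}\times\{1,\dots,m\}$ satisfy $|I_0|+|I_1|=d$ and ${\rm rank}\big(P(\{\alpha e_j:(\alpha,j)\in I_0\cup I_1\})\big)=d$, let $I_1,\dots,I_M$, $M=2^{d-|I_0|}$, be all the distinct families obtained from $I_1$ by replacing any number of its elements $(\alpha,j)$ by $(-\alpha,j)$, let $$F=\Big(\bigcap_{(\alpha,j)\in I_0}\overline{\overline L}(\alpha,j)\Big)\cap\Big(\bigcap_{i=1}^M\bigcap_{(\alpha,j)\in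 I_i}L(\alpha,j)\Big),$$ and for $i\in\{1,\dots,M\}$ let $y_{*,i}$ be the unique $y\in\mathcal{V}$ with $\langle e_j,Ay\rangle=c_j^\alpha$ for all $(\alpha,j)\in I_0\cup I_i$. Assume that $c_j^-<\langle e_j,Ay_{*,i}\rangle<c_j^+$ for all $i\in\{1,\dots,M\}$ and every spring index $j$ that does not occur in $I_0\cup I_1\cup\dots\cup I_M$, and that $c_j^-<c_j^+$ for every $j$ occurring in $I_1\cup\dots\cup I_M$. Then there exists $\varepsilon>0$ such that for every $\tau_d>0$ $$-\dot c(t)+B^A_\varepsilon(0)\cap N^A_F(y)\subset N^A_C(y)\quad\text{for all }y\in F\text{ and a.a. }t\in[0,\tau_d],$$ and, in particular, the solution $y$ of the sweeping process $-\dot y(t)\in N^A_{C(t)}(y(t))$ with initial condition $y(0)\in C(0)$ satisfies $y(\tau_d)\in F+c(\tau_d)$ for all sufficiently large $\tau_d>0$. Accordingly, the stress vector $s(t)$ of the elastoplastic system satisfies $s(\tau_d)\in{\rm conv}\{Ay_{*,1},\dots,Ay_{*,M}\}$ if $|I_0|<d$ (respectively $s(\tau_d)=Ay_{*,0}$ if $|I_0|=d$) for all sufficiently large $\tau_d$.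
   Context: Setting: $m\ge n\ge2$; $D$ is an $m\times n$ matrix (kinematic matrix of a connected network of $m$ springs on $n$ nodes) with ${\rm rank}\,D=n-1$; $A={\rm diag}(a_1,\dots,a_m)$ with all $a_j>0$; $c_j^-\le c_j^+$ are the elastic limits of spring $j$; $R\in\mathbb{R}^m$ with ${\rm rank}(D^TR)=1$; $l:[0,\infty)\to\mathbb{R}$ is the (Lipschitz) displacement-controlled loading. Put $d=m-n+2$. Choose: an $n\times(n-2)$-matrix $Q$ with ${\rm rank}(DQ)=n-2$ and $R^TDQ=0$; an $m\times d$-matrix $\mathcal{V}_{basis}$ with linearly independent columns and $(DQ)^TA\mathcal{V}_{basis}=0$; an $m\times(m-n+1)$-matrix $D^\perp$ of rank $m-n+1$ with $(D^\perp)^TD=0$. Let $P=\begin{pmatrix}R^T\\(D^\perp)^T\end{pmatrix}$ (a $d\times m$-matrix), $W=P\,\mathcal{V}_{basis}$ (an invertible $d\times d$-matrix), $\mathcal{V}=\mathcal{V}_{basis}\mathbb{R}^d$ with scalar product $(x,y)_A=\langle x,Ay\rangle$, and $c(t)=-\mathcal{V}_{basis}W^{-1}\begin{pmatrix}1\\0_{m-n+1}\end{pmatrix}l(t)$. With $e_j$ the standard basis of $\mathbb{R}^m$ and $c_j^\alpha=c_j^{\pm}$ for $\alpha=\pm1$: $L(\alpha,j)=\{y\in\mathcal{V}:\langle\alpha e_j,Ay\rangle\le\alpha c_j^\alpha\}$, $\overline{\overline L}(\alpha,j)=\{y\in\mathcal{V}:\langle e_j,Ay\rangle=c_j^\alpha\}$,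 $C=\{y\in\mathcal{V}:c_j^-\le\langle e_j,Ay\rangle\le c_j^+,\ j=1,\dots,m\}$, $C(t)=C+c(t)$. A solution of the sweeping process is a locally absolutely continuous $y:[0,\infty)\to\mathcal{V}$ with $y(t)\in C(t)$ for all $t$ satisfying the inclusion a.e. The stress vector of the elastoplastic system is $s(t)=A(y(t)-c(t))$. ${\rm cone}(S)$ is the set of nonnegative linear combinations of elements of $S$ (${\rm cone}(\emptyset)=\{0\}$); $P\{\cdot\}$ denotes the images under $P$, and $P(\{\cdot\})$ the matrix with these columns. $\|x\|^A=\sqrt{\langle x,Ax\rangle}$; $B^A_\varepsilon(0)=\{x\in\mathcal{V}:\|x\|^A\le\varepsilon\}$; for closed convex $K\subset\mathcal{V}$, $N^A_K(y)=\{x\in\mathcal{V}:\langle x,A(\xi-y)\rangle\le0\ \forall\xi\in K\}$ if $y\in K$ and $\emptyset$ otherwise. *)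

theory Defs
  imports "HOL-Analysis.Analysis"
begin

(* One-dimensional network on the line: spring j joins the nodes src j and tgt j, and the
   kinematic matrix sends node displacements to spring elongations,
   (D x) $ j = x $ tgt j - x $ src j.  The orientation of each spring is arbitrary. *)
definition connected_kinematic_matrix :: "real^'n^'m \<Rightarrow> bool" where
  "connected_kinematic_matrix D \<longleftrightarrow>
     (\<exists>src tgt :: 'm \<Rightarrow> 'n.
        (\<forall>j. src j \<noteq> tgt j) \<and>
        (\<forall>u v. (u, v) \<in> (range (\<lambda>j. (src j, tgt j)) \<union> range (\<lambda>j. (tgt j, src j)))\<^sup>*) \<and>
        D = (\<chi> j i. if i = tgt j then 1 else if i = src j then - 1 else 0))"

definition diag_matrix :: "real^'m \<Rightarrow> real^'m^'m" where
  "diag_matrix a = (\<chi> i j. if i = j then a $ i else 0)"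

(* R transposed stacked on top of the transpose of Dp.  The d = m - n + 2 rows are indexed by
   'k option, where 'k indexes the m - n + 1 columns of Dp; None is the top row. *)
definition stacked_matrix :: "real^'m \<Rightarrow> real^'k^'m \<Rightarrow> real^'m^('k option)" where
  "stacked_matrix R Dp = (\<chi> i. case i of None \<Rightarrow> R | Some k \<Rightarrow> column k Dp)"

definition nonneg_cone :: "'a::real_vector set \<Rightarrow> 'a set" where
  "nonneg_cone S = {(\<Sum>x\<in>T. u x *\<^sub>R x) | T u. finite T \<and> T \<subseteq> S \<and> (\<forall>x\<in>T. 0 \<le> u x)}"

(* In the next three definitions V is a subspace, carrying the scalar product x \<bullet> (A *v y). *)
definition norm_A :: "real^'m^'m \<Rightarrow> real^'m \<Rightarrow> real" where
  "norm_A A x = sqrt (x \<bullet> (A *v x))"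

definition ball_A :: "(real^'m) set \<Rightarrow> real^'m^'m \<Rightarrow> real \<Rightarrow> (real^'m) set" where
  "ball_A V A \<epsilon> = {x \<in> V. norm_A A x \<le> \<epsilon>}"

definition normal_cone_A :: "(real^'m) set \<Rightarrow> real^'m^'m \<Rightarrow> (real^'m) set \<Rightarrow> real^'m \<Rightarrow> (real^'m) set" where
  "normal_cone_A V A K y =
     (if y \<in> K then {x \<in> V. \<forall>\<xi>\<in>K. x \<bullet> (A *v (\<xi> - y)) \<le> 0} else {})"

(* A spring face is a pair (\<alpha>, j) with \<alpha> = 1 (upper limit) or \<alpha> = -1 (lower limit). *)
definition elastic_limit :: "real^'m \<Rightarrow> real^'m \<Rightarrow> real \<Rightarrow> 'm \<Rightarrow> real" where
  "elastic_limit cm cp \<alpha> j = (if \<alpha> = 1 then cp $ j else cm $ j)"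

definition face_vectors :: "(real \<times> 'm) set \<Rightarrow> (real^'m) set" where
  "face_vectors I = {\<alpha> *\<^sub>R axis j 1 | \<alpha> j. (\<alpha>, j) \<in> I}"

(* All families obtained from I by replacing an arbitrary subset T of its elements by the
   elements of opposite sign. *)
definition sign_changes :: "(real \<times> 'm) set \<Rightarrow> (real \<times> 'm) set set" where
  "sign_changes I = {(I - T) \<union> (\<lambda>(\<alpha>, j). (- \<alpha>, j)) ` T | T. T \<subseteq> I}"

definition face_vertex ::
  "(real^'m) set \<Rightarrow> real^'m^'m \<Rightarrow> real^'m \<Rightarrow> real^'m \<Rightarrow> (real \<times> 'm) set \<Rightarrow> real^'m" where
  "face_vertex V A cm cp I =
     (THE y. y \<in> V \<and> (\<forall>(\<alpha>, j)\<in>I. axis j 1 \<bullet> (A *v y) = elastic_limit cm cp \<alpha> j))"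

(* The usual epsilon-delta notion; the members of a division are nonempty compact intervals
   k = {Inf k..Sup k} with disjoint interiors. *)
definition abs_continuous_on :: "real set \<Rightarrow> (real \<Rightarrow> 'a::real_normed_vector) \<Rightarrow> bool" where
  "abs_continuous_on S f \<longleftrightarrow>
     (\<forall>\<epsilon>>0. \<exists>\<delta>>0. \<forall>\<D> T. \<D> division_of T \<and> T \<subseteq> S \<and> (\<Sum>k\<in>\<D>. measure lborel k) < \<delta>
        \<longrightarrow> (\<Sum>k\<in>\<D>. norm (f (Sup k) - f (Inf k))) < \<epsilon>)"

definition sweeping_solution ::
  "(real^'m) set \<Rightarrow> real^'m^'m \<Rightarrow> (real \<Rightarrow> (real^'m) set) \<Rightarrow> (real \<Rightarrow> real^'m) \<Rightarrow> bool" where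
  "sweeping_solution V A Ct y \<longleftrightarrow>
     (\<forall>\<tau>>0. abs_continuous_on {0..\<tau>} y) \<and>
     (\<forall>t\<ge>0. y t \<in> V) \<and>
     (\<forall>t\<ge>0. y t \<in> Ct t) \<and>
     (AE t in lebesgue. 0 \<le> t \<longrightarrow>
        (\<exists>y'. (y has_vector_derivative y') (at t) \<and> - y' \<in> normal_cone_A V A (Ct t) (y t)))"

end

theory Submission
  imports Defs
begin

text \<open>
  The image \<open>P x\<close> determines \<open>\<langle>x, A y\<rangle>\<close> for \<open>y \<in> V\<close>, because the kernel of \<open>P\<close> is spanned by the columns of
  \<open>D Q\<close>. Hence \<open>-c'(t)\<close> is represented on \<open>V\<close> by a combination of the outer normals \<open>\<alpha> e\<^sub>j\<close>, \<open>(\<alpha>, j) \<in> I\<^sub>0\<close>,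
  whose coefficients are positive by irreducibility, and the \<open>d\<close> stresses with spring index in
  \<open>I\<^sub>0 \<union> I\<^sub>1\<close> are coordinates on \<open>V\<close>. In these coordinates \<open>F\<close> is a box, contained in \<open>C\<close> since its
  vertices are, and a small element of the normal cone of \<open>F\<close> cannot change the signs of the
  coefficients of \<open>-c'(t)\<close> on \<open>I\<^sub>0\<close>. This gives the inclusion of normal cones.

  Let \<open>x = y - c\<close> have the projection \<open>p\<close> on \<open>F\<close>. Testing the sweeping inclusion with \<open>p\<close>, and the
  inclusion of normal cones with \<open>x\<close> and the normal \<open>\<epsilon> (x - p) / \<parallel>x - p\<parallel>\<close>, yields
  \<open>(x', x - p) \<le> -\<epsilon> \<parallel>x - p\<parallel>\<close> almost everywhere, so the distance from \<open>x\<close> to \<open>F\<close> vanishes after a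
  finite time.
\<close>

section \<open>Absolutely continuous functions\<close>

lemma real_division_member:
  fixes T :: "real set"
  assumes "\<D> division_of T" "k \<in> \<D>"
  shows "Inf k \<le> Sup k" "Inf k \<in> T" "Sup k \<in> T" "measure lborel k = Sup k - Inf k"
proof -
  obtain u v where k: "k = cbox u v" using division_ofD(4)[OF assms] by blast
  moreover have "k \<noteq> {}" "k \<subseteq> T" using division_ofD(2,3)[OF assms] by auto
  ultimately show "Inf k \<le> Sup k" "Inf k \<in> T" "Sup k \<in> T" "measure lborel k = Sup k - Inf k"
    by auto
qed

lemma abs_continuous_onD:
  assumes "abs_continuous_on S f" "e > 0"
  obtains \<delta> where "\<delta> > 0" "\<forall>\<D> T. \<D> division_of T \<longrightarrow> T \<subseteq> S \<longrightarrow> (\<Sum>k\<in>\<D>. measure lborel k) < \<delta>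
      \<longrightarrow> (\<Sum>k\<in>\<D>. norm (f (Sup k) - f (Inf k))) < e"
proof -
  obtain \<delta> where "\<delta> > 0" and \<delta>: "\<forall>\<D> T. \<D> division_of T \<and> T \<subseteq> S \<and> (\<Sum>k\<in>\<D>. measure lborel k) < \<delta>
      \<longrightarrow> (\<Sum>k\<in>\<D>. norm (f (Sup k) - f (Inf k))) < e"
    using assms(1)[unfolded abs_continuous_on_def, THEN spec, THEN mp, OF assms(2)] by (elim exE conjE)
  show thesis
    by (rule that[OF \<open>\<delta> > 0\<close>], intro allI impI, rule \<delta>[THEN spec, THEN spec, THEN mp]) simp
qed

lemma abs_continuous_on_subset:
  assumes "abs_continuous_on S f" "T \<subseteq> S"
  shows "abs_continuous_on T f"
  unfolding abs_continuous_on_def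
proof (intro allI impI)
  fix e :: real assume "e > 0"
  obtain \<delta> where \<delta>: "\<delta> > 0" "\<forall>\<D> T. \<D> division_of T \<longrightarrow> T \<subseteq> S \<longrightarrow> (\<Sum>k\<in>\<D>. measure lborel k) < \<delta>
      \<longrightarrow> (\<Sum>k\<in>\<D>. norm (f (Sup k) - f (Inf k))) < e"
    by (rule abs_continuous_onD[OF assms(1) \<open>e > 0\<close>])
  show "\<exists>\<delta>>0. \<forall>\<D> T'. \<D> division_of T' \<and> T' \<subseteq> T \<and> (\<Sum>k\<in>\<D>. measure lborel k) < \<delta>
        \<longrightarrow> (\<Sum>k\<in>\<D>. norm (f (Sup k) - f (Inf k))) < e"
    using \<delta>(1) \<delta>(2)[rule_format, OF _ subset_trans[OF _ assms(2)]] by (intro exI[of _ \<delta>]) blast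
qed

text \<open>Splitting \<open>e\<close> between the two terms of the bound transfers absolute
  continuity from \<open>g\<close> to \<open>f\<close>. It is applied to rescaled curves, to
  truncated distances and to distances with a linear drift.\<close>

lemma abs_continuous_on_dominated:
  fixes f :: "real \<Rightarrow> 'a::real_normed_vector" and g :: "real \<Rightarrow> 'b::real_normed_vector"
  assumes ac: "abs_continuous_on S g" and K: "K \<ge> 0" "K' \<ge> 0"
    and dom: "\<And>s t. s \<in> S \<Longrightarrow> t \<in> S \<Longrightarrow> s \<le> t \<Longrightarrow> norm (f t - f s) \<le> K * norm (g t - g s) + K' * (t - s)"
  shows "abs_continuous_on S f"
  unfolding abs_continuous_on_def
proof (intro allI impI)
  fix e :: real assume "e > 0"
  \<comment> \<open>Adding 1 to \<open>K\<close> and \<open>K'\<close> keeps the denominators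
    positive when a constant is 0 and makes the final estimate strict.\<close>
  define e1 where "e1 = e / (2 * (K + 1))"
  define e2 where "e2 = e / (2 * (K' + 1))"
  have e12: "e1 > 0" "e2 > 0" using \<open>e > 0\<close> K by (auto simp: e1_def e2_def)
  obtain \<delta> where \<delta>: "\<delta> > 0" "\<forall>\<D> T. \<D> division_of T \<longrightarrow> T \<subseteq> S \<longrightarrow> (\<Sum>k\<in>\<D>. measure lborel k) < \<delta>
      \<longrightarrow> (\<Sum>k\<in>\<D>. norm (g (Sup k) - g (Inf k))) < e1"
    by (rule abs_continuous_onD[OF ac e12(1)])
  show "\<exists>\<delta>>0. \<forall>\<D> T. \<D> division_of T \<and> T \<subseteq> S \<and> (\<Sum>k\<in>\<D>. measure lborel k) < \<delta>
        \<longrightarrow> (\<Sum>k\<in>\<D>. norm (f (Sup k) - f (Inf k))) < e"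
  proof (intro exI[of _ "min \<delta> e2"] conjI allI impI)
    show "0 < min \<delta> e2" using \<delta>(1) e12 by simp
    fix \<D> T assume A: "\<D> division_of T \<and> T \<subseteq> S \<and> (\<Sum>k\<in>\<D>. measure lborel k) < min \<delta> e2"
    then have D: "\<D> division_of T" and T: "T \<subseteq> S" by auto
    have "norm (f (Sup k) - f (Inf k)) \<le> K * norm (g (Sup k) - g (Inf k)) + K' * measure lborel k"
      if "k \<in> \<D>" for k
      using real_division_member[OF D that] dom[of "Inf k" "Sup k"] T by (metis subsetD)
    then have "(\<Sum>k\<in>\<D>. norm (f (Sup k) - f (Inf k)))
        \<le> (\<Sum>k\<in>\<D>. K * norm (g (Sup k) - g (Inf k)) + K' * measure lborel k)"
      by (rule sum_mono)
    also have "\<dots> = K * (\<Sum>k\<in>\<D>. norm (g (Sup k) - g (Inf k))) + K' * (\<Sum>k\<in>\<D>. measure lborel k)"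
      by (simp add: sum.distrib sum_distrib_left)
    also have "\<dots> \<le> K * e1 + K' * e2"
      using \<delta>(2)[rule_format, OF D T] A K by (intro add_mono mult_left_mono) auto
    also have "\<dots> < (K + 1) * e1 + (K' + 1) * e2"
      using e12 by (simp add: algebra_simps)
    also have "\<dots> = e"
    proof -
      have "(K + 1) * e1 = e / 2" "(K' + 1) * e2 = e / 2"
        using K by (simp_all add: e1_def e2_def divide_simps)
      then show ?thesis by simp
    qed
    finally show "(\<Sum>k\<in>\<D>. norm (f (Sup k) - f (Inf k))) < e" .
  qed
qed

text \<open>The proof sums increments over a fine tagged division. Intervals tagged outside
  \<open>N\<close> gain at most \<open>e\<close> times their length by \<open>der\<close>; those
  tagged in \<open>N\<close> lie in an open set of small measure, where absolute continuity bounds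
  the total gain. The form of \<open>der\<close> suits distance functions, for which only estimates
  of increments on either side of \<open>t\<close> are at hand.\<close>

lemma abs_continuous_on_nonincreasing:
  fixes f :: "real \<Rightarrow> real"
  assumes ac: "abs_continuous_on {a..b} f" and "a \<le> b" and N: "N \<in> null_sets lebesgue"
    and der: "\<And>t e. t \<in> {a..b} - N \<Longrightarrow> e > 0 \<Longrightarrow> \<exists>\<delta>>0. \<forall>s\<in>{a..b}. \<bar>s - t\<bar> < \<delta> \<longrightarrow>
       (t \<le> s \<longrightarrow> f s \<le> f t + e * (s - t)) \<and> (s \<le> t \<longrightarrow> f t \<le> f s + e * (t - s))"
  shows "f b \<le> f a"
proof (rule field_le_epsilon)
  fix e0 :: real assume "e0 > 0"
  \<comment> \<open>Chosen so that \<open>e * (b - a) \<le> e0 / 2\<close>; the added 1 covers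
    \<open>a = b\<close>.\<close>
  define e where "e = e0 / (2 * (b - a + 1))"
  have "e > 0" using \<open>e0 > 0\<close> \<open>a \<le> b\<close> by (simp add: e_def)
  obtain \<delta> where \<delta>: "\<delta> > 0" "\<forall>\<D> T. \<D> division_of T \<longrightarrow> T \<subseteq> {a..b} \<longrightarrow> (\<Sum>k\<in>\<D>. measure lborel k) < \<delta>
      \<longrightarrow> (\<Sum>k\<in>\<D>. norm (f (Sup k) - f (Inf k))) < e0 / 2"
    by (rule abs_continuous_onD[OF ac half_gt_zero[OF \<open>e0 > 0\<close>]])
  \<comment> \<open>Outer regularity covers the null set by an open set whose measure is below the
    threshold \<open>\<delta>\<close> of absolute continuity.\<close>
  obtain U where U: "open U" "N \<subseteq> U" "U \<in> lmeasurable" "measure lebesgue U < \<delta>"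
  proof -
    have *: "N \<in> lmeasurable" "measure lebesgue N = 0"
      using N negligible_iff_measure negligible_iff_null_sets by blast+
    obtain U where U: "open U" "N \<subseteq> U" "U - N \<in> lmeasurable" "emeasure lebesgue (U - N) < ennreal \<delta>"
      using sets_lebesgue_outer_open[of N \<delta>] * \<delta>(1) by (metis fmeasurableD)
    have "U = (U - N) \<union> N" using U by auto
    then have 1: "U \<in> lmeasurable" using U(3) *(1) by (metis fmeasurable.Un)
    have "measure lebesgue U \<le> measure lebesgue (U - N) + measure lebesgue N"
      using \<open>U = (U - N) \<union> N\<close> U(3) *(1) by (metis fmeasurableD measure_Un_le)
    moreover have "measure lebesgue (U - N) < \<delta>"
      using U(3,4) \<delta>(1) by (simp add: emeasure_eq_measure2 ennreal_less_iff)
    ultimately show thesis using that U 1 * by auto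
  qed
  \<comment> \<open>The gauge: at a tag in \<open>N\<close> the ball stays in \<open>U\<close>, at
    any other tag in the interval the estimate \<open>der\<close> applies. Outside
    \<open>{a..b}\<close> the radius 1 is a dummy value.\<close>
  have "\<exists>r>0. (t \<in> N \<longrightarrow> ball t r \<subseteq> U) \<and> (t \<in> {a..b} - N \<longrightarrow> (\<forall>s\<in>{a..b}. \<bar>s - t\<bar> < r \<longrightarrow>
       (t \<le> s \<longrightarrow> f s \<le> f t + e * (s - t)) \<and> (s \<le> t \<longrightarrow> f t \<le> f s + e * (t - s))))" for t
  proof (cases "t \<in> N")
    case True
    then show ?thesis using U(1,2) open_contains_ball by blast
  next
    case False
    then show ?thesis using der[of t, OF _ \<open>e > 0\<close>] by (cases "t \<in> {a..b}") (auto intro: exI[of _ 1])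
  qed
  then obtain r where r: "\<And>t. r t > 0" "\<And>t. t \<in> N \<Longrightarrow> ball t (r t) \<subseteq> U"
    "\<And>t s. t \<in> {a..b} - N \<Longrightarrow> s \<in> {a..b} \<Longrightarrow> \<bar>s - t\<bar> < r t \<Longrightarrow>
       (t \<le> s \<longrightarrow> f s \<le> f t + e * (s - t)) \<and> (s \<le> t \<longrightarrow> f t \<le> f s + e * (t - s))"
    by metis
  obtain p where p: "p tagged_division_of {a..b}" "(\<lambda>t. ball t (r t)) fine p"
    using fine_division_exists_real gauge_ball_dependent r(1) by blast
  have fin: "finite p" using p(1) by blast
  have mem: "x \<in> k \<and> k \<subseteq> {a..b} \<and> Inf k \<in> k \<and> Sup k \<in> k \<and> Inf k \<le> x \<and> x \<le> Sup k
      \<and> measure lborel k = Sup k - Inf k \<and> k \<subseteq> ball x (r x)" if xk: "(x, k) \<in> p" for x k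
  proof -
    obtain u v where "k = cbox u v" using tagged_division_ofD(4)[OF p(1) xk] by blast
    moreover have "x \<in> k" "k \<subseteq> {a..b}" using tagged_division_ofD(2,3)[OF p(1) xk] by auto
    moreover have "k \<subseteq> ball x (r x)" using p(2) xk by (auto simp: fine_def)
    ultimately show ?thesis by auto
  qed
  define p1 where "p1 = {(x, k) \<in> p. x \<in> N}"
  define p2 where "p2 = {(x, k) \<in> p. x \<notin> N}"
  have p12: "p = p1 \<union> p2" "p1 \<inter> p2 = {}" "p1 \<subseteq> p" "p2 \<subseteq> p" by (auto simp: p1_def p2_def)
  have good: "(\<Sum>(x, k)\<in>p2. f (Sup k) - f (Inf k)) \<le> e * (b - a)"
  proof -
    \<comment> \<open>The tag \<open>x\<close> cuts \<open>k\<close> into a right and a left piece,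
      and each half of \<open>der\<close> handles one of them.\<close>
    have "f (Sup k) - f (Inf k) \<le> e * measure lborel k" if "(x, k) \<in> p2" for x k
    proof -
      have xk: "(x, k) \<in> p" "x \<notin> N" using that by (auto simp: p2_def)
      note m = mem[OF xk(1)]
      have "f (Sup k) \<le> f x + e * (Sup k - x)"
        using r(3)[of x "Sup k"] m xk(2) by (force simp: dist_real_def)
      moreover have "f x \<le> f (Inf k) + e * (x - Inf k)"
        using r(3)[of x "Inf k"] m xk(2) by (force simp: dist_real_def)
      moreover have "measure lborel k = Sup k - Inf k" using m by blast
      ultimately show ?thesis by (simp only:) (simp add: algebra_simps)
    qed
    then have "(\<Sum>(x, k)\<in>p2. f (Sup k) - f (Inf k)) \<le> (\<Sum>(x, k)\<in>p2. e * measure lborel k)"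
      by (intro sum_mono) auto
    also have "\<dots> \<le> (\<Sum>(x, k)\<in>p. e * measure lborel k)"
      using \<open>e > 0\<close> fin p12 by (intro sum_mono2) auto
    also have "\<dots> = e * (\<Sum>(x, k)\<in>p. measure lborel k)"
      by (simp add: sum_distrib_left case_prod_unfold)
    also have "\<dots> = e * (b - a)"
      using additive_content_tagged_division[of p a b] p(1) \<open>a \<le> b\<close> by simp
    finally show ?thesis .
  qed
  have bad: "(\<Sum>(x, k)\<in>p1. f (Sup k) - f (Inf k)) \<le> e0 / 2"
  proof -
    \<comment> \<open>Only degenerate intervals can carry several tags. As \<open>d\<close> vanishes
      on them, the sum over tagged pairs equals the sum over the division \<open>?D\<close>.\<close>
    define d where "d k = (if measure lborel k = 0 then 0 else norm (f (Sup k) - f (Inf k)))" for k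
    have pp: "p1 tagged_partial_division_of {a..b}"
      using tagged_partial_division_subset p(1) p12(3) tagged_division_of_def by blast
    let ?D = "snd ` p1"
    have D: "?D division_of \<Union>?D" by (rule partial_division_of_tagged_division[OF pp])
    have sub: "\<Union>?D \<subseteq> {a..b}" "\<Union>?D \<subseteq> U"
    proof -
      have "k \<subseteq> {a..b} \<and> k \<subseteq> U" if kD: "k \<in> ?D" for k
      proof -
        obtain x where x: "(x, k) \<in> p" "x \<in> N" using kD by (auto simp: p1_def)
        show ?thesis using mem[OF x(1)] r(2)[OF x(2)] by blast
      qed
      then show "\<Union>?D \<subseteq> {a..b}" "\<Union>?D \<subseteq> U" by blast+
    qed
    have finD: "finite ?D" using fin p12(3) finite_subset by blast
    have "(\<Sum>k\<in>?D. measure lborel k) = measure lebesgue (\<Union>?D)"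
    proof -
      have "measure lborel k = measure lebesgue k" if "k \<in> ?D" for k
        using division_ofD(4)[OF D that] by (auto simp: measure_completion)
      then show ?thesis using content_division[OF D] by simp
    qed
    also have "\<dots> \<le> measure lebesgue U"
      using sub(2) U(3) D by (intro measure_mono_fmeasurable) (auto intro: lmeasurable_division fmeasurableD)
    finally have sumD: "(\<Sum>k\<in>?D. norm (f (Sup k) - f (Inf k))) < e0 / 2"
      using \<delta>(2)[rule_format, OF D sub(1)] U(4) by simp
    have "(\<Sum>(x, k)\<in>p1. f (Sup k) - f (Inf k)) \<le> (\<Sum>(x, k)\<in>p1. d k)"
    proof (rule sum_mono, clarify)
      fix x k assume "(x, k) \<in> p1"
      then show "f (Sup k) - f (Inf k) \<le> d k"
        using mem[of x k] p12(3) by (auto simp: d_def)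
    qed
    also have "\<dots> = sum d ?D"
      by (rule sum.over_tagged_division_lemma[OF tagged_partial_division_of_Union_self[OF pp]])
         (auto simp: d_def content_eq_0_interior)
    also have "\<dots> \<le> (\<Sum>k\<in>?D. norm (f (Sup k) - f (Inf k)))"
      by (rule sum_mono) (auto simp: d_def)
    also have "\<dots> \<le> e0 / 2" using sumD by simp
    finally show ?thesis .
  qed
  have "f b - f a = (\<Sum>(x, k)\<in>p. f (Sup k) - f (Inf k))"
    by (rule additive_tagged_division_1[OF \<open>a \<le> b\<close> p(1), symmetric])
  also have "\<dots> = (\<Sum>(x, k)\<in>p1. f (Sup k) - f (Inf k)) + (\<Sum>(x, k)\<in>p2. f (Sup k) - f (Inf k))"
    using fin p12 by (metis (no_types, lifting) finite_Un sum.union_disjoint)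
  also have "\<dots> \<le> e0 / 2 + e * (b - a)" using good bad by simp
  also have "\<dots> \<le> e0"
  proof -
    have "e * (b - a) \<le> e * (b - a + 1)" using \<open>e > 0\<close> by simp
    also have "\<dots> = e0 / 2" using \<open>a \<le> b\<close> by (simp add: e_def field_simps)
    finally show ?thesis by simp
  qed
  finally show "f b \<le> f a + e0" by simp
qed

section \<open>Curves attracted by a convex set\<close>

lemma has_real_derivative_expansion:
  fixes f :: "real \<Rightarrow> real"
  assumes "(f has_real_derivative D) (at t)" "e > 0"
  obtains \<delta> where "\<delta> > 0" "\<And>s. \<bar>s - t\<bar> < \<delta> \<Longrightarrow> \<bar>f s - f t - D * (s - t)\<bar> \<le> e * \<bar>s - t\<bar>"
  using assms unfolding has_field_derivative_def has_derivative_at_alt real_norm_def by metis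

text \<open>The distance to a convex set is squeezed between the distance to the closest point and
  to its supporting hyperplane there, and both bounds have the same derivative.\<close>
lemma setdist_along_curve:
  fixes F :: "'a::euclidean_space set" and u :: "real \<Rightarrow> 'a"
  defines "g \<equiv> \<lambda>t. setdist {u t} F"
  assumes F: "closed F" "convex F" "F \<noteq> {}"
    and u': "(u has_vector_derivative u') (at t)"
    and dec: "u' \<bullet> (u t - closest_point F (u t)) \<le> - \<epsilon> * norm (u t - closest_point F (u t))"
    and pos: "g t > 0" and "e > 0"
  obtains \<delta> where "\<delta> > 0"
    "\<And>s. \<bar>s - t\<bar> < \<delta> \<Longrightarrow> t \<le> s \<Longrightarrow> g s \<le> g t - \<epsilon> * (s - t) + e * (s - t)"
    "\<And>s. \<bar>s - t\<bar> < \<delta> \<Longrightarrow> s \<le> t \<Longrightarrow> g t \<le> g s - \<epsilon> * (t - s) + e * (t - s)"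
proof -
  define p where "p = closest_point F (u t)"
  define n where "n = sgn (u t - p)"
  have gt: "g t = norm (u t - p)"
    using setdist_closest_point[OF F(1,3)] by (simp add: g_def p_def dist_norm)
  have ne: "u t - p \<noteq> 0" using pos gt by auto
  have pF: "p \<in> F" using F by (simp add: p_def closest_point_in_set)
  have n1: "norm n = 1" using ne by (simp add: n_def norm_sgn)
  have nu: "n \<bullet> (u t - p) = g t"
    using ne by (simp add: n_def gt sgn_div_norm power2_norm_eq_inner[symmetric] power2_eq_square)
  \<comment> \<open>\<open>D\<close> will be the derivative at \<open>t\<close> of both bounds;
    dividing \<open>dec\<close> by the positive norm gives
    \<open>D \<le> - \<epsilon>\<close>.\<close>
  define D where "D = n \<bullet> u'"
  have D: "D \<le> - \<epsilon>"
  proof -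
    have "D * norm (u t - p) \<le> - \<epsilon> * norm (u t - p)"
    proof -
      have "D = ((u t - p) \<bullet> u') / norm (u t - p)"
        by (simp add: D_def n_def sgn_div_norm divide_inverse mult.commute)
      then show ?thesis using dec ne by (simp add: p_def[symmetric] inner_commute)
    qed
    then show ?thesis using ne by (subst (asm) mult_le_cancel_right) simp
  qed
  have upper: "((\<lambda>s. norm (u s - p)) has_real_derivative D) (at t)"
  proof -
    have "((\<lambda>s. u s - p) has_derivative (\<lambda>h. h *\<^sub>R u')) (at t)"
      using u' unfolding has_vector_derivative_def by (auto intro!: derivative_eq_intros)
    from has_derivative_compose[OF this has_derivative_norm[OF ne]] show ?thesis
      by (simp add: has_field_derivative_def D_def n_def inner_commute mult_commute_abs)
  qed
  have lower: "((\<lambda>s. n \<bullet> (u s - p)) has_real_derivative D) (at t)"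
    using u' unfolding has_field_derivative_def has_vector_derivative_def D_def
    by (auto intro!: derivative_eq_intros)
  obtain \<delta>1 where \<delta>1: "\<delta>1 > 0" "\<And>s. \<bar>s - t\<bar> < \<delta>1 \<Longrightarrow>
      \<bar>norm (u s - p) - norm (u t - p) - D * (s - t)\<bar> \<le> e * \<bar>s - t\<bar>"
    using has_real_derivative_expansion[OF upper \<open>e > 0\<close>] by metis
  obtain \<delta>2 where \<delta>2: "\<delta>2 > 0" "\<And>s. \<bar>s - t\<bar> < \<delta>2 \<Longrightarrow>
      \<bar>n \<bullet> (u s - p) - n \<bullet> (u t - p) - D * (s - t)\<bar> \<le> e * \<bar>s - t\<bar>"
    using has_real_derivative_expansion[OF lower \<open>e > 0\<close>] by metis
  have up: "g s \<le> norm (u s - p)" for s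
    using setdist_le_dist[of "u s" "{u s}" p F] pF by (simp add: g_def dist_norm)
  \<comment> \<open>The projection \<open>p\<close> has \<open>F\<close> in the half-space
    \<open>n \<bullet> (q - p) \<le> 0\<close>, and \<open>n\<close> is a unit vector, so the linear
    functional stays below the distance to every \<open>q\<close> in \<open>F\<close>.\<close>
  have low: "n \<bullet> (u s - p) \<le> g s" for s
    unfolding g_def
  proof (rule le_setdistI)
    fix x q assume "x \<in> {u s}" "q \<in> F"
    have "(u t - p) \<bullet> (q - p) \<le> 0"
      using closest_point_dot[OF F(2,1) \<open>q \<in> F\<close>] by (simp add: p_def)
    then have "n \<bullet> (q - p) \<le> 0"
      using ne by (simp add: n_def sgn_div_norm mult_nonneg_nonpos)
    then have "n \<bullet> (u s - p) \<le> n \<bullet> (u s - q)" by (simp add: inner_diff_right)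
    also have "\<dots> \<le> norm (u s - q)" using norm_cauchy_schwarz[of n "u s - q"] n1 by simp
    finally show "n \<bullet> (u s - p) \<le> dist x q" using \<open>x \<in> {u s}\<close> by (simp add: dist_norm)
  qed (use F in auto)
  show thesis
  proof (rule that[of "min \<delta>1 \<delta>2"])
    fix s assume s: "\<bar>s - t\<bar> < min \<delta>1 \<delta>2"
    have Ds: "D * r \<le> - \<epsilon> * r" if "r \<ge> 0" for r
      using D that by (rule mult_right_mono)
    \<comment> \<open>Forward in time the norm bounds the distance from above, backward in time the
      hyperplane bounds it from below; both bounds are exact at \<open>t\<close>.\<close>
    show "g s \<le> g t - \<epsilon> * (s - t) + e * (s - t)" if "t \<le> s"
      using \<delta>1(2)[of s] s up[of s] gt Ds[of "s - t"] that by simp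
    show "g t \<le> g s - \<epsilon> * (t - s) + e * (t - s)" if "s \<le> t"
    proof -
      have "D * (s - t) = - (D * (t - s))" by (simp add: algebra_simps)
      then show ?thesis
        using \<delta>2(2)[of s] s low[of s] nu Ds[of "t - s"] that by simp
    qed
  qed (use \<delta>1 \<delta>2 in auto)
qed

text \<open>While it is positive, the distance from \<open>u\<close> to \<open>F\<close> decreases
  at rate at least \<open>\<epsilon>\<close>, so it cannot still be positive at any time beyond its
  initial value divided by \<open>\<epsilon>\<close>.\<close>

lemma eventually_mem_of_attraction:
  fixes F :: "'a::euclidean_space set" and u :: "real \<Rightarrow> 'a"
  assumes F: "closed F" "convex F" "F \<noteq> {}" and "\<epsilon> > 0"
    and ac: "\<And>\<tau>. \<tau> > 0 \<Longrightarrow> abs_continuous_on {0..\<tau>} u"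
    and der: "AE t in lebesgue. 0 \<le> t \<longrightarrow> (\<exists>u'. (u has_vector_derivative u') (at t) \<and>
       u' \<bullet> (u t - closest_point F (u t)) \<le> - \<epsilon> * norm (u t - closest_point F (u t)))"
  shows "\<forall>\<^sub>F \<tau> in at_top. u \<tau> \<in> F"
proof -
  define g where "g = (\<lambda>t. setdist {u t} F)"
  have g0: "g t \<ge> 0" for t by (simp add: g_def)
  have glip: "\<bar>g s - g t\<bar> \<le> norm (u s - u t)" for s t
    using setdist_Lipschitz[of "u s" F "u t"] by (simp add: g_def dist_norm)
  obtain N where N: "N \<in> null_sets lebesgue" and Nder: "\<And>t. t \<notin> N \<Longrightarrow> 0 \<le> t \<Longrightarrow>
      \<exists>u'. (u has_vector_derivative u') (at t) \<and>
       u' \<bullet> (u t - closest_point F (u t)) \<le> - \<epsilon> * norm (u t - closest_point F (u t))"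
    using der unfolding eventually_ae_filter subset_iff by auto metis
  have expand: "\<exists>\<delta>>0. \<forall>s. \<bar>s - t\<bar> < \<delta> \<longrightarrow>
      (t \<le> s \<longrightarrow> g s \<le> g t - \<epsilon> * (s - t) + e * (s - t)) \<and>
      (s \<le> t \<longrightarrow> g t \<le> g s - \<epsilon> * (t - s) + e * (t - s))"
    if "t \<notin> N" "0 \<le> t" "g t > 0" "e > 0" for t e
  proof -
    obtain u' where "(u has_vector_derivative u') (at t)"
      "u' \<bullet> (u t - closest_point F (u t)) \<le> - \<epsilon> * norm (u t - closest_point F (u t))"
      using Nder \<open>t \<notin> N\<close> \<open>0 \<le> t\<close> by blast
    from setdist_along_curve[OF F this] that(3,4) show ?thesis
      unfolding g_def by metis
  qed
  \<comment> \<open>The decrease is known only where \<open>g\<close> is positive. Truncating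
    \<open>g\<close> from below at \<open>\<eta>\<close> gives a function that is controlled at all
    times outside \<open>N\<close>, and shows that a small distance stays small.\<close>
  have noninc: "g b \<le> max (g a) \<eta>" if ab: "0 \<le> a" "a < b" and "\<eta> > 0" for a b \<eta>
  proof -
    define \<phi> where "\<phi> = (\<lambda>t. max (g t) \<eta>)"
    have "abs_continuous_on {a..b} u"
      using abs_continuous_on_subset[OF ac[of b]] ab by auto
    then have acp: "abs_continuous_on {a..b} \<phi>"
    proof (rule abs_continuous_on_dominated[where K = 1 and K' = 0])
      show "norm (\<phi> t - \<phi> s) \<le> 1 * norm (u t - u s) + 0 * (t - s)" for s t
        using glip[of t s] by (simp add: \<phi>_def max_def abs_if split: if_splits)
    qed auto
    have "\<phi> b \<le> \<phi> a"
    proof (rule abs_continuous_on_nonincreasing[OF acp _ N])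
      fix t e :: real assume t: "t \<in> {a..b} - N" and "e > 0"
      show "\<exists>\<delta>>0. \<forall>s\<in>{a..b}. \<bar>s - t\<bar> < \<delta> \<longrightarrow>
         (t \<le> s \<longrightarrow> \<phi> s \<le> \<phi> t + e * (s - t)) \<and> (s \<le> t \<longrightarrow> \<phi> t \<le> \<phi> s + e * (t - s))"
      proof (cases "g t < \<eta>")
        case True
        \<comment> \<open>Below the level \<open>\<eta>\<close> the truncation is constant near
          \<open>t\<close>, by continuity of \<open>u\<close> and the Lipschitz bound
          \<open>glip\<close>.\<close>
        have "isCont u t"
          using Nder[of t] t ab has_vector_derivative_continuous by fastforce
        then obtain \<delta> where \<delta>: "\<delta> > 0" "\<And>s. \<bar>s - t\<bar> < \<delta> \<Longrightarrow> norm (u s - u t) < \<eta> - g t"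
          unfolding continuous_at_eps_delta dist_norm real_norm_def
          using True by (meson diff_gt_0_iff_gt)
        have "\<phi> s = \<eta>" if "\<bar>s - t\<bar> < \<delta>" for s
          using \<delta>(2)[OF that] glip[of s t] by (simp add: \<phi>_def)
        moreover have "\<phi> t = \<eta>" using True by (simp add: \<phi>_def)
        ultimately show ?thesis using \<delta>(1) \<open>e > 0\<close> by (intro exI[of _ \<delta>]) auto
      next
        case False
        then have "g t > 0" using \<open>\<eta> > 0\<close> by simp
        then obtain \<delta> where \<delta>: "\<delta> > 0" "\<And>s. \<bar>s - t\<bar> < \<delta> \<Longrightarrow>
            (t \<le> s \<longrightarrow> g s \<le> g t - \<epsilon> * (s - t) + e * (s - t)) \<and>
            (s \<le> t \<longrightarrow> g t \<le> g s - \<epsilon> * (t - s) + e * (t - s))"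
          using expand[of t e] t ab \<open>e > 0\<close> by auto
        have "(t \<le> s \<longrightarrow> \<phi> s \<le> \<phi> t + e * (s - t)) \<and> (s \<le> t \<longrightarrow> \<phi> t \<le> \<phi> s + e * (t - s))"
          if "\<bar>s - t\<bar> < \<delta>" for s
        proof -
          have "0 \<le> \<epsilon> * (s - t)" "0 \<le> e * (s - t)" if "t \<le> s" using that \<open>\<epsilon> > 0\<close> \<open>e > 0\<close> by simp_all
          moreover have "0 \<le> \<epsilon> * (t - s)" "0 \<le> e * (t - s)" if "s \<le> t" using that \<open>\<epsilon> > 0\<close> \<open>e > 0\<close> by simp_all
          ultimately show ?thesis
            using \<delta>(2)[OF that] False unfolding \<phi>_def by linarith
        qed
        then show ?thesis using \<delta>(1) by blast
      qed
    qed (use ab in simp)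
    then show ?thesis by (simp add: \<phi>_def)
  qed
  have "g \<tau> = 0" if \<tau>: "\<tau> > 0" "\<epsilon> * \<tau> > g 0" for \<tau>
  proof (rule ccontr)
    assume "g \<tau> \<noteq> 0"
    then have "g \<tau> > 0" using g0[of \<tau>] by simp
    \<comment> \<open>An earlier zero of \<open>g\<close> would, by \<open>noninc\<close> at level
      \<open>g \<tau> / 2\<close>, force \<open>g \<tau> \<le> g \<tau> / 2\<close>.\<close>
    have gpos: "g t > 0" if "t \<in> {0..\<tau>}" for t
      using noninc[of t \<tau> "g \<tau> / 2"] \<open>g \<tau> > 0\<close> that g0[of t] by (cases "t = \<tau>") auto
    \<comment> \<open>Adding back the guaranteed decrease leaves a nonincreasing function; then
      \<open>g \<tau> + \<epsilon> * \<tau> \<le> g 0\<close> contradicts the choice of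
      \<open>\<tau>\<close>.\<close>
    define f where "f = (\<lambda>t. g t + \<epsilon> * t)"
    have acf: "abs_continuous_on {0..\<tau>} f"
    proof (rule abs_continuous_on_dominated[OF ac[OF \<tau>(1)], where K = 1 and K' = \<epsilon>])
      fix s t :: real assume "s \<le> t"
      have "norm (f t - f s) = \<bar>(g t - g s) + \<epsilon> * (t - s)\<bar>" by (simp add: f_def algebra_simps)
      also have "\<dots> \<le> \<bar>g t - g s\<bar> + \<epsilon> * (t - s)" using \<open>s \<le> t\<close> \<open>\<epsilon> > 0\<close> by (simp add: abs_triangle_ineq order_trans[OF abs_triangle_ineq])
      also have "\<dots> \<le> 1 * norm (u t - u s) + \<epsilon> * (t - s)" using glip[of t s] by simp
      finally show "norm (f t - f s) \<le> 1 * norm (u t - u s) + \<epsilon> * (t - s)" .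
    qed (use \<open>\<epsilon> > 0\<close> in auto)
    have "f \<tau> \<le> f 0"
    proof (rule abs_continuous_on_nonincreasing[OF acf _ N])
      fix t e :: real assume t: "t \<in> {0..\<tau>} - N" and "e > 0"
      then obtain \<delta> where \<delta>: "\<delta> > 0" "\<And>s. \<bar>s - t\<bar> < \<delta> \<Longrightarrow>
            (t \<le> s \<longrightarrow> g s \<le> g t - \<epsilon> * (s - t) + e * (s - t)) \<and>
            (s \<le> t \<longrightarrow> g t \<le> g s - \<epsilon> * (t - s) + e * (t - s))"
        using expand[of t e] gpos[of t] by auto
      then show "\<exists>\<delta>>0. \<forall>s\<in>{0..\<tau>}. \<bar>s - t\<bar> < \<delta> \<longrightarrow>
         (t \<le> s \<longrightarrow> f s \<le> f t + e * (s - t)) \<and> (s \<le> t \<longrightarrow> f t \<le> f s + e * (t - s))"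
        by (intro exI[of _ \<delta>]) (auto simp: f_def algebra_simps)
    qed (use \<tau> in simp)
    then show False using \<tau>(2) \<open>g \<tau> > 0\<close> by (simp add: f_def)
  qed
  moreover have "\<forall>\<^sub>F \<tau> in at_top. \<tau> > 0 \<and> \<epsilon> * \<tau> > g 0"
  proof (rule eventually_conj)
    show "\<forall>\<^sub>F \<tau> in at_top. \<tau> > (0::real)" by (rule eventually_gt_at_top)
    show "\<forall>\<^sub>F \<tau> in at_top. \<epsilon> * \<tau> > g 0"
      using eventually_gt_at_top[of "g 0 / \<epsilon>"] by eventually_elim (use \<open>\<epsilon> > 0\<close> in \<open>simp add: field_simps\<close>)
  qed
  moreover have "u \<tau> \<in> F" if "g \<tau> = 0" for \<tau>
    using that F setdist_closest_point[OF F(1,3), of "u \<tau>"] closest_point_in_set[OF F(1,3), of "u \<tau>"]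
    by (simp add: g_def)
  ultimately show ?thesis by (auto elim!: eventually_mono)
qed

section \<open>Irreducible conic combinations\<close>

text \<open>Coefficients are moved from vectors to indices, although \<open>v\<close> may take a
  value several times: one index is selected per vector in one direction, and coefficients are
  summed over fibres in the other.\<close>

lemma nonneg_cone_image:
  fixes v :: "'i \<Rightarrow> 'a::real_vector"
  assumes "finite I"
  shows "nonneg_cone (v ` I) = {(\<Sum>i\<in>I. q i *\<^sub>R v i) | q. \<forall>i\<in>I. 0 \<le> q i}"
proof (intro set_eqI iffI)
  fix x assume "x \<in> nonneg_cone (v ` I)"
  then obtain T u where T: "finite T" "T \<subseteq> v ` I" "\<forall>z\<in>T. 0 \<le> u z" and x: "x = (\<Sum>z\<in>T. u z *\<^sub>R z)"
    unfolding nonneg_cone_def by blast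
  obtain I' where I': "I' \<subseteq> I" "inj_on v I'" "T = v ` I'"
    using T(2) by (auto simp: subset_image_inj)
  define q where "q i = (if i \<in> I' then u (v i) else 0)" for i
  have "(\<Sum>i\<in>I. q i *\<^sub>R v i) = (\<Sum>i\<in>I'. u (v i) *\<^sub>R v i)"
    using assms I'(1) by (intro sum.mono_neutral_cong_right) (auto simp: q_def)
  also have "\<dots> = x"
    using I' by (simp add: x sum.reindex)
  finally show "x \<in> {(\<Sum>i\<in>I. q i *\<^sub>R v i) | q. \<forall>i\<in>I. 0 \<le> q i}"
    using T(3) I'(3) by (auto intro!: exI[of _ q] simp: q_def)
next
  fix x assume "x \<in> {(\<Sum>i\<in>I. q i *\<^sub>R v i) | q. \<forall>i\<in>I. 0 \<le> q i}"
  then obtain q where x: "x = (\<Sum>i\<in>I. q i *\<^sub>R v i)" and q: "\<forall>i\<in>I. 0 \<le> q i" by blast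
  define u where "u z = (\<Sum>i\<in>{i \<in> I. v i = z}. q i)" for z
  have "x = (\<Sum>z\<in>v ` I. \<Sum>i\<in>{i \<in> I. v i = z}. q i *\<^sub>R v i)"
    unfolding x using assms by (rule sum.image_gen)
  also have "\<dots> = (\<Sum>z\<in>v ` I. u z *\<^sub>R z)"
    by (intro sum.cong refl) (simp add: u_def scaleR_left.sum)
  finally show "x \<in> nonneg_cone (v ` I)"
    using assms q unfolding nonneg_cone_def
    by (intro CollectI exI[of _ "v ` I"] exI[of _ u]) (auto simp: u_def intro: sum_nonneg)
qed

text \<open>Caratheodory's exchange argument. A zero coefficient would allow its index to be
  dropped; a nontrivial relation \<open>\<mu>\<close> could be subtracted with a suitable factor
  until some coefficient becomes zero.\<close>

lemma irreducible_conic_combination: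
  fixes v :: "'i \<Rightarrow> 'a::real_vector"
  assumes fin: "finite I" and x: "x = (\<Sum>i\<in>I. q i *\<^sub>R v i)" and q: "\<forall>i\<in>I. 0 \<le> q i"
    and irr: "\<forall>p\<in>I. x \<notin> nonneg_cone (v ` (I - {p}))"
  shows "\<forall>i\<in>I. 0 < q i"
    and "(\<Sum>i\<in>I. \<mu> i *\<^sub>R v i) = 0 \<Longrightarrow> \<forall>i\<in>I. \<mu> i = 0"
proof -
  have drop: False if p: "p \<in> I" "r p = 0" "\<forall>i\<in>I. 0 \<le> r i" "x = (\<Sum>i\<in>I. r i *\<^sub>R v i)" for p r
  proof -
    have "x = (\<Sum>i\<in>I - {p}. r i *\<^sub>R v i)"
      using p fin by (simp add: sum.remove)
    then have "x \<in> nonneg_cone (v ` (I - {p}))"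
      using p(3) fin by (subst nonneg_cone_image) auto
    then show False using irr p(1) by blast
  qed
  show pos: "\<forall>i\<in>I. 0 < q i"
    using drop[OF _ _ q x] q by (metis order_le_less)
  have nonpos: "\<mu> i \<le> 0" if \<mu>: "(\<Sum>i\<in>I. \<mu> i *\<^sub>R v i) = 0" and i: "i \<in> I" for \<mu> i
  proof (rule ccontr)
    assume "\<not> \<mu> i \<le> 0"
    define S where "S = {j \<in> I. \<mu> j > 0}"
    have S: "finite S" "S \<noteq> {}" using fin i \<open>\<not> \<mu> i \<le> 0\<close> by (auto simp: S_def)
    \<comment> \<open>The minimal ratio is the largest multiple of the relation that leaves all
      coefficients nonnegative, and it annihilates the coefficient of \<open>p\<close>.\<close>
    obtain p where p: "p \<in> S" "\<And>j. j \<in> S \<Longrightarrow> q p / \<mu> p \<le> q j / \<mu> j"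
      using ex_min_if_finite[of "(\<lambda>j. q j / \<mu> j) ` S"] S by (force simp: not_less)
    define t where "t = q p / \<mu> p"
    have "t \<ge> 0" using p(1) q by (simp add: t_def S_def)
    have "0 \<le> q j - t * \<mu> j" if j: "j \<in> I" for j
    proof (cases "\<mu> j > 0")
      case True
      then show ?thesis using p(2)[of j] j by (simp add: S_def t_def[symmetric] pos_le_divide_eq)
    next
      case False
      then show ?thesis using q j \<open>t \<ge> 0\<close> by (simp add: mult_nonneg_nonpos order_trans[of _ 0])
    qed
    moreover have "(\<Sum>j\<in>I. (q j - t * \<mu> j) *\<^sub>R v j) = x - t *\<^sub>R (\<Sum>j\<in>I. \<mu> j *\<^sub>R v j)"
      by (simp add: x scaleR_diff_left sum_subtractf scaleR_right.sum)
    moreover have "q p - t * \<mu> p = 0" using p(1) by (simp add: t_def S_def)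
    ultimately show False using drop[of p "\<lambda>j. q j - t * \<mu> j"] p(1) \<mu> by (auto simp: S_def)
  qed
  show "\<forall>i\<in>I. \<mu> i = 0" if \<mu>: "(\<Sum>i\<in>I. \<mu> i *\<^sub>R v i) = 0"
  proof
    fix i assume i: "i \<in> I"
    \<comment> \<open>The sign result for the negated relation gives the opposite
      inequality.\<close>
    have "(\<Sum>i\<in>I. - \<mu> i *\<^sub>R v i) = 0" using \<mu> by (simp add: sum_negf)
    then show "\<mu> i = 0" using nonpos[OF \<mu> i] nonpos[of "\<lambda>i. - \<mu> i" i] i by simp
  qed
qed

text \<open>Independence of an indexed family also excludes repeated vectors, since
  \<open>v i = v j\<close> yields the relation \<open>v i - v j = 0\<close>; hence indices may be
  counted instead of vectors.\<close>

lemma dim_image_of_independent_family: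
  fixes v :: "'i \<Rightarrow> 'a::euclidean_space"
  assumes fin: "finite I" and ind: "\<And>\<mu>. (\<Sum>i\<in>I. \<mu> i *\<^sub>R v i) = 0 \<Longrightarrow> \<forall>i\<in>I. \<mu> i = 0"
  shows "dim (v ` I) = card I"
proof -
  have inj: "inj_on v I"
  proof (rule inj_onI, rule ccontr)
    fix i j assume ij: "i \<in> I" "j \<in> I" "v i = v j" "i \<noteq> j"
    define \<mu> :: "'i \<Rightarrow> real" where "\<mu> k = (if k = i then 1 else 0) - (if k = j then 1 else 0)" for k
    have "(\<Sum>k\<in>I. \<mu> k *\<^sub>R v k) = (\<Sum>k\<in>I. (if k = i then v k else 0) - (if k = j then v k else 0))"
      by (intro sum.cong) (auto simp: \<mu>_def)
    also have "\<dots> = 0" using ij fin by (simp add: sum_subtractf)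
    finally have "\<mu> i = 0" using ind ij(1) by blast
    then show False using ij(4) by (simp add: \<mu>_def)
  qed
  have "independent (v ` I)"
  proof
    assume "dependent (v ` I)"
    then obtain u z where u: "z \<in> v ` I" "u z \<noteq> 0" "(\<Sum>z\<in>v ` I. u z *\<^sub>R z) = 0"
      using fin by (auto simp: dependent_finite)
    then have "(\<Sum>i\<in>I. u (v i) *\<^sub>R v i) = 0" using inj by (simp add: sum.reindex)
    then show False using ind[of "\<lambda>i. u (v i)"] u by auto
  qed
  then show ?thesis using inj by (simp add: dim_eq_card_independent card_image)
qed

lemma face_vectors_image:
  "(*v) P ` face_vectors I = (\<lambda>(\<alpha>, j). P *v (\<alpha> *\<^sub>R axis j 1)) ` I"
  by (force simp: face_vectors_def)

section \<open>The kinematic subspace\<close>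

lemma inner_diag_matrix: "x \<bullet> (diag_matrix a *v y) = (\<Sum>i\<in>UNIV. a $ i * (x $ i * y $ i))"
proof -
  have "(diag_matrix a *v y) $ i = a $ i * y $ i" for i
  proof -
    have "(diag_matrix a *v y) $ i = (\<Sum>j\<in>UNIV. (if i = j then a $ i * y $ j else 0))"
      unfolding matrix_vector_mult_def diag_matrix_def vec_lambda_beta by (rule sum.cong) auto
    then show ?thesis by (simp only: sum.delta'[OF finite]) simp
  qed
  then show ?thesis by (simp add: inner_vec_def mult.left_commute)
qed

lemma inner_diag_matrix_self_eq_0:
  assumes "\<forall>j. a $ j > 0" "x \<bullet> (diag_matrix a *v x) = 0"
  shows "x = 0"
proof -
  have "\<forall>i\<in>UNIV. a $ i * (x $ i * x $ i) = 0"
    using assms by (subst sum_nonneg_eq_0_iff[symmetric]) (auto simp: inner_diag_matrix less_imp_le)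
  then show ?thesis using assms(1) by (simp add: vec_eq_iff) (metis less_irrefl)
qed

lemma stacked_matrix_mult_eq_0:
  "stacked_matrix R Dp *v x = 0 \<longleftrightarrow> R \<bullet> x = 0 \<and> (\<forall>z. (Dp *v z) \<bullet> x = 0)"
proof -
  have all_opt: "(\<forall>i. Q i) \<longleftrightarrow> Q None \<and> (\<forall>k. Q (Some k))" for Q :: "'c option \<Rightarrow> bool"
    by (metis option.exhaust)
  have row: "(stacked_matrix R Dp *v x) $ i = (case i of None \<Rightarrow> R \<bullet> x | Some k \<Rightarrow> column k Dp \<bullet> x)" for i
    by (cases i) (simp_all add: matrix_vector_mult_def stacked_matrix_def inner_vec_def)
  have col: "(Dp *v z) \<bullet> x = (\<Sum>k\<in>UNIV. z $ k * (column k Dp \<bullet> x))" for z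
    by (simp add: matrix_mult_sum inner_sum_left scalar_mult_eq_scaleR)
  have "column k Dp \<bullet> x = 0" if "\<forall>z. (Dp *v z) \<bullet> x = 0" for k
    using that[rule_format, of "axis k 1"] by (simp add: matrix_vector_mult_basis)
  then show ?thesis
    by (auto simp: vec_eq_iff row col all_opt split: option.split)
qed

text \<open>A dimension count. The orthogonal complement of the range of \<open>Dp\<close> has
  dimension \<open>n - 1\<close> and therefore equals the range of \<open>D\<close>. On that range
  \<open>R\<close> is a nonzero functional, so its zero set \<open>S\<close> has dimension at most
  \<open>n - 2\<close> and is filled by the columns of \<open>D Q\<close>.\<close>

lemma kernel_stacked_matrix:
  fixes D :: "real^'n^'m" and R :: "real^'m" and Dp :: "real^'k^'m" and Q :: "nat \<Rightarrow> real^'n"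
  assumes mn: "CARD('m) \<ge> CARD('n)" "CARD('n) \<ge> 2"
    and k: "CARD('k) = CARD('m) - CARD('n) + 1"
    and rD: "rank D = CARD('n) - 1"
    and R: "rank (columnvector (transpose D *v R) :: real^1^'n) = 1"
    and Q: "dim ((\<lambda>i. D *v Q i) ` {..<CARD('n) - 2}) = CARD('n) - 2"
    and RQ: "\<forall>i<CARD('n) - 2. R \<bullet> (D *v Q i) = 0"
    and Dp: "rank Dp = CARD('k)" "transpose Dp ** D = 0"
    and x: "stacked_matrix R Dp *v x = 0"
  shows "x \<in> span ((\<lambda>i. D *v Q i) ` {..<CARD('n) - 2})"
proof -
  define U where "U = range ((*v) D)"
  define T where "T = range ((*v) Dp)"
  define T' where "T' = {y \<in> UNIV. \<forall>t\<in>T. orthogonal t y}"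
  define S where "S = {y \<in> U. R \<bullet> y = 0}"
  have dimU: "dim U = CARD('n) - 1" using rD by (simp add: U_def rank_dim_range)
  have dimT: "dim T = CARD('k)" using Dp(1) by (simp add: T_def rank_dim_range)
  have sub: "subspace U" "subspace T" "subspace T'" "subspace S"
    unfolding U_def T_def T'_def S_def
    by (auto simp: subspace_def orthogonal_def inner_add_right linear_subspace_image
        intro: range_eqI[of _ _ 0])
       (metis matrix_vector_right_distrib rangeI, metis matrix_vector_mult_scaleR rangeI)+
  have "dim T' + dim T = CARD('m)"
    using dim_subspace_orthogonal_to_vectors[OF sub(2) subspace_UNIV] by (simp add: T'_def)
  then have dimT': "dim T' = CARD('n) - 1" using dimT k mn by simp
  have "U \<subseteq> T'"
  proof -
    have "(Dp *v z) \<bullet> (D *v w) = 0" for z w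
    proof -
      have "(Dp *v z) \<bullet> (D *v w) = z \<bullet> (transpose Dp *v (D *v w))"
        by (metis dot_lmul_matrix inner_commute transpose_matrix_vector)
      then show ?thesis by (simp only: matrix_vector_mul_assoc Dp(2)) simp
    qed
    then show ?thesis by (auto simp: U_def T_def T'_def orthogonal_def)
  qed
  then have "U = T'" using sub dimU dimT' by (intro subspace_dim_equal) auto
  have xS: "x \<in> S"
    using x \<open>U = T'\<close> by (auto simp: stacked_matrix_mult_eq_0 S_def T'_def T_def orthogonal_def)
  \<comment> \<open>The rank condition on \<open>R\<close> enters here: \<open>D\<close> applied to
    this nonzero vector lies in \<open>U\<close>, and its product with \<open>R\<close> is the
    squared norm of the vector, so \<open>S\<close> is a proper subspace of
    \<open>U\<close>.\<close>
  have "transpose D *v R \<noteq> 0"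
  proof
    assume "transpose D *v R = 0"
    then have "columnvector (transpose D *v R) = (0 :: real^1^'n)"
      by (simp add: columnvector_def vec_eq_iff)
    then show False using R by (simp add: rank_dim_range)
  qed
  moreover have "R \<bullet> (D *v (transpose D *v R)) = (transpose D *v R) \<bullet> (transpose D *v R)"
    by (metis dot_lmul_matrix transpose_matrix_vector)
  ultimately have "D *v (transpose D *v R) \<notin> S" by (simp add: S_def)
  then have "S \<subset> U" by (auto simp: S_def U_def)
  then have dimS: "dim S < CARD('n) - 1"
    using sub dimU dim_psubset[of S U] by (simp add: span_eq_iff[THEN iffD2])
  have "span ((\<lambda>i. D *v Q i) ` {..<CARD('n) - 2}) = S"
  proof (rule subspace_dim_equal)
    show "span ((\<lambda>i. D *v Q i) ` {..<CARD('n) - 2}) \<subseteq> S"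
      using RQ sub by (intro span_minimal) (auto simp: S_def U_def)
  qed (use sub Q dimS in auto)
  then show ?thesis using xS by simp
qed

lemma orthogonal_range_of_orthogonal_columns:
  fixes Vb :: "real^'d^'m"
  assumes "\<And>i k. i \<in> I \<Longrightarrow> u i \<bullet> (A *v column k Vb) = 0"
    and "x \<in> span (u ` I)" and y: "y \<in> range ((*v) Vb)"
  shows "x \<bullet> (A *v y) = 0"
proof -
  obtain z where "y = Vb *v z" using y by blast
  then have "A *v y = (\<Sum>k\<in>UNIV. z $ k *\<^sub>R (A *v column k Vb))"
    by (simp add: matrix_mult_sum[of Vb] scalar_mult_eq_scaleR linear_sum[OF matrix_vector_mul_linear]
        matrix_vector_mult_scaleR)
  then have base: "u i \<bullet> (A *v y) = 0" if "i \<in> I" for i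
    using assms(1)[OF that] by (simp add: inner_sum_right)
  show ?thesis using assms(2)
    by (induction rule: span_induct) (auto simp: subspace_def inner_add_left base)
qed

lemma inj_mult_of_independent_columns:
  fixes Vb :: "real^'d^'m"
  assumes "inj (\<lambda>i. column i Vb)" "independent (columns Vb)"
  shows "inj ((*v) Vb)" and "dim (range ((*v) Vb)) = CARD('d)"
proof -
  have "columns Vb = range (\<lambda>i. column i Vb)" by (auto simp: columns_def)
  then have "rank Vb = CARD('d)"
    using assms by (simp add: column_rank_def dim_eq_card_independent card_image)
  then show "inj ((*v) Vb)" "dim (range ((*v) Vb)) = CARD('d)"
    by (simp_all add: full_rank_injective[symmetric] rank_dim_range)
qed

text \<open>As many functionals as the dimension, with trivial common kernel on \<open>V\<close>,
  form coordinates; \<open>w\<close> is the basis of \<open>V\<close> dual to them.\<close>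

lemma dual_frame_exists:
  fixes \<phi> :: "'i::finite \<Rightarrow> 'a::euclidean_space \<Rightarrow> real"
  assumes V: "subspace V" "dim V = card J" and lin: "\<And>j. linear (\<phi> j)"
    and sep: "\<And>y. y \<in> V \<Longrightarrow> \<forall>j\<in>J. \<phi> j y = 0 \<Longrightarrow> y = 0"
  obtains w where "\<And>j. j \<in> J \<Longrightarrow> w j \<in> V"
    "\<And>j k. j \<in> J \<Longrightarrow> k \<in> J \<Longrightarrow> \<phi> k (w j) = (if k = j then 1 else 0)"
    "\<And>y. y \<in> V \<Longrightarrow> y = (\<Sum>j\<in>J. \<phi> j y *\<^sub>R w j)"
proof -
  \<comment> \<open>\<open>J\<close> is a set and not a type, so the coordinate map takes values in
    the full space, with zeros outside \<open>J\<close>; \<open>E\<close> below is that coordinate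
    subspace.\<close>
  define \<Psi> :: "'a \<Rightarrow> real^'i" where "\<Psi> y = (\<chi> j. if j \<in> J then \<phi> j y else 0)" for y
  have lin\<Psi>: "linear \<Psi>"
    by (rule linearI) (auto simp: \<Psi>_def vec_eq_iff linear_add[OF lin] linear_cmul[OF lin])
  define E where "E = {x::real^'i. \<forall>i. i \<notin> J \<longrightarrow> x $ i = 0}"
  have inj: "inj_on \<Psi> V"
  proof (rule inj_onI)
    fix y z assume yz: "y \<in> V" "z \<in> V" "\<Psi> y = \<Psi> z"
    have "\<phi> j (y - z) = 0" if "j \<in> J" for j
      using arg_cong[OF yz(3), of "\<lambda>x. x $ j"] that by (simp add: \<Psi>_def linear_diff[OF lin])
    then show "y = z" using sep[of "y - z"] yz V by (simp add: subspace_diff)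
  qed
  have "\<Psi> ` V = E"
  proof (rule subspace_dim_equal)
    show "subspace (\<Psi> ` V)" using V lin\<Psi> by (simp add: linear_subspace_image)
    show "subspace E" by (auto simp: E_def subspace_def)
    show "\<Psi> ` V \<subseteq> E" by (auto simp: E_def \<Psi>_def)
    have "dim E = card J"
      using dim_substandard_cart[where d = J and 'a = real] by (simp add: E_def dim_vec_eq)
    moreover have "dim (\<Psi> ` V) = dim V"
      using inj V by (intro dim_image_eq[OF lin\<Psi>]) (simp add: span_eq_iff[THEN iffD2])
    ultimately show "dim E \<le> dim (\<Psi> ` V)" using V by simp
  qed
  then have "\<exists>w\<in>V. \<Psi> w = axis j 1" if "j \<in> J" for j
  proof -
    have "axis j 1 \<in> E" using that by (auto simp: E_def axis_def)
    then show ?thesis using \<open>\<Psi> ` V = E\<close> by (metis imageE)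
  qed
  then obtain w where w: "\<And>j. j \<in> J \<Longrightarrow> w j \<in> V" "\<And>j. j \<in> J \<Longrightarrow> \<Psi> (w j) = axis j 1" by metis
  have dual: "\<phi> k (w j) = (if k = j then 1 else 0)" if "j \<in> J" "k \<in> J" for j k
    using arg_cong[OF w(2)[OF that(1)], of "\<lambda>x. x $ k"] that(2) by (auto simp: \<Psi>_def axis_def)
  have "y = (\<Sum>j\<in>J. \<phi> j y *\<^sub>R w j)" if y: "y \<in> V" for y
  proof -
    have "\<phi> k (\<Sum>j\<in>J. \<phi> j y *\<^sub>R w j) = \<phi> k y" if "k \<in> J" for k
    proof -
      have "\<phi> k (\<Sum>j\<in>J. \<phi> j y *\<^sub>R w j) = (\<Sum>j\<in>J. \<phi> j y * \<phi> k (w j))"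
        by (simp add: linear_sum[OF lin] linear_cmul[OF lin])
      also have "\<dots> = (\<Sum>j\<in>J. if k = j then \<phi> j y else 0)"
        using that by (intro sum.cong) (auto simp: dual)
      also have "\<dots> = \<phi> k y" using that by simp
      finally show ?thesis .
    qed
    then have "\<forall>k\<in>J. \<phi> k (y - (\<Sum>j\<in>J. \<phi> j y *\<^sub>R w j)) = 0"
      by (simp add: linear_diff[OF lin])
    moreover have "y - (\<Sum>j\<in>J. \<phi> j y *\<^sub>R w j) \<in> V"
      using y V w by (intro subspace_diff subspace_sum subspace_scale) auto
    ultimately show ?thesis using sep by fastforce
  qed
  then show thesis using that w(1) dual by blast
qed

section \<open>Faces of the elastic set\<close>

text \<open>The square root of the matrix \<open>A\<close>. It maps the scalar product given by
  \<open>A\<close> to the Euclidean one, which makes Euclidean projections and the Cauchy-Schwarz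
  inequality available.\<close>

definition sqrt_scale :: "real^'m \<Rightarrow> real^'m \<Rightarrow> real^'m" where
  "sqrt_scale a x = (\<chi> i. sqrt (a $ i) * x $ i)"

lemma linear_sqrt_scale: "linear (sqrt_scale a)"
  by (rule linearI) (simp_all add: sqrt_scale_def vec_eq_iff algebra_simps)

lemma inner_sqrt_scale:
  assumes "\<forall>j. a $ j > 0"
  shows "sqrt_scale a x \<bullet> sqrt_scale a y = x \<bullet> (diag_matrix a *v y)"
proof -
  have root: "sqrt (a $ i) * sqrt (a $ i) = a $ i" for i
    using assms by (simp add: less_imp_le)
  have "sqrt_scale a x \<bullet> sqrt_scale a y = (\<Sum>i\<in>UNIV. (sqrt (a $ i) * sqrt (a $ i)) * (x $ i * y $ i))"
    unfolding inner_vec_def sqrt_scale_def by (intro sum.cong) (simp_all add: mult_ac)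
  then show ?thesis by (simp only: root inner_diag_matrix)
qed

lemma norm_sqrt_scale:
  assumes "\<forall>j. a $ j > 0"
  shows "norm (sqrt_scale a x) = norm_A (diag_matrix a) x"
  by (simp add: norm_eq_sqrt_inner inner_sqrt_scale[OF assms] norm_A_def)

lemma inj_sqrt_scale:
  assumes "\<forall>j. a $ j > 0"
  shows "inj (sqrt_scale a)"
  using assms by (auto intro!: injI simp: sqrt_scale_def vec_eq_iff) (metis less_irrefl)

text \<open>The stresses of the springs in \<open>J\<close> are coordinates on \<open>V\<close>, and
  \<open>w\<close> is the dual basis. The set \<open>J\<close> will consist of the springs of
  \<open>I0\<close>, or of \<open>I0\<close> and \<open>I1\<close> together.\<close>

locale elastic_frame =
  fixes V :: "(real^'m) set" and a cm cp :: "real^'m" and J :: "'m set" and w :: "'m \<Rightarrow> real^'m"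
  assumes a_pos: "\<forall>j. a $ j > 0" and V: "subspace V"
    and w_mem: "\<And>j. j \<in> J \<Longrightarrow> w j \<in> V"
    and w_dual: "\<And>j k. j \<in> J \<Longrightarrow> k \<in> J \<Longrightarrow>
       axis k 1 \<bullet> (diag_matrix a *v w j) = (if k = j then 1 else 0)"
    and w_expand: "\<And>y. y \<in> V \<Longrightarrow> y = (\<Sum>j\<in>J. (axis j 1 \<bullet> (diag_matrix a *v y)) *\<^sub>R w j)"
begin

definition stress :: "'m \<Rightarrow> real^'m \<Rightarrow> real" where
  "stress j y = axis j 1 \<bullet> (diag_matrix a *v y)"

lemma linear_stress: "linear (stress j)"
  unfolding stress_def
  by (rule linearI) (simp_all add: matrix_vector_right_distrib inner_add_right matrix_vector_mult_scaleR)

lemmas stress_simps = linear_add[OF linear_stress] linear_diff[OF linear_stress]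
  linear_cmul[OF linear_stress] linear_sum[OF linear_stress]

lemma stress_w: "j \<in> J \<Longrightarrow> k \<in> J \<Longrightarrow> stress k (w j) = (if k = j then 1 else 0)"
  using w_dual by (simp add: stress_def)

lemma expand: "y \<in> V \<Longrightarrow> y = (\<Sum>j\<in>J. stress j y *\<^sub>R w j)"
  using w_expand by (simp add: stress_def)

lemma inner_expand:
  assumes "y \<in> V"
  shows "x \<bullet> (diag_matrix a *v y) = (\<Sum>j\<in>J. stress j y * (x \<bullet> (diag_matrix a *v w j)))"
  by (subst expand[OF assms])
     (simp add: linear_sum[OF matrix_vector_mul_linear] matrix_vector_mult_scaleR inner_sum_right)

lemma eq_of_stress_eq:
  assumes "y \<in> V" "z \<in> V" "\<And>j. j \<in> J \<Longrightarrow> stress j y = stress j z"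
  shows "y = z"
  using expand[OF assms(1)] expand[OF assms(2)] assms(3) by simp

definition elastic_set :: "(real^'m) set" where
  "elastic_set = {y \<in> V. \<forall>j. cm $ j \<le> stress j y \<and> stress j y \<le> cp $ j}"

text \<open>The set \<open>F\<close> of both cases: the springs of \<open>I\<close> sit at a
  prescribed limit and those of \<open>K\<close> range between their limits. \<open>K\<close> is
  empty for a vertex and is the set of springs of \<open>I1\<close> for a box.\<close>

definition spring_face :: "(real \<times> 'm) set \<Rightarrow> 'm set \<Rightarrow> (real^'m) set" where
  "spring_face I K = {y \<in> V. (\<forall>(\<alpha>, j)\<in>I. stress j y = elastic_limit cm cp \<alpha> j) \<and>
     (\<forall>j\<in>K. cm $ j \<le> stress j y \<and> stress j y \<le> cp $ j)}"

lemma spring_face_eq_vimage: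
  "spring_face I K = V \<inter> (\<Inter>(\<alpha>, j)\<in>I. stress j -` {elastic_limit cm cp \<alpha> j}) \<inter>
     (\<Inter>j\<in>K. stress j -` {cm $ j..cp $ j})"
  by (auto simp: spring_face_def)

lemma convex_spring_face: "convex (spring_face I K)"
  unfolding spring_face_eq_vimage
  by (intro convex_Int convex_INT subspace_imp_convex[OF V])
     (auto simp: case_prod_unfold intro!: convex_linear_vimage linear_stress)

lemma closed_spring_face: "closed (spring_face I K)"
  unfolding spring_face_eq_vimage
  by (intro closed_Int closed_INT closed_subspace[OF V])
     (auto simp: case_prod_unfold intro!: continuous_closed_vimage linear_continuous_at
        linear_stress[THEN linear_linear[THEN iffD2]])

text \<open>Among the stresses in \<open>J\<close>, the direction \<open>w k\<close> changes only
  that of \<open>k\<close>. These moves serve as test points for normal cones and as segments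
  through non-extreme points.\<close>

lemma spring_face_move:
  assumes J: "J = snd ` I \<union> K" and disj: "snd ` I \<inter> K = {}" and y: "y \<in> spring_face I K"
    and k: "k \<in> K" and \<delta>: "cm $ k \<le> stress k y + \<delta>" "stress k y + \<delta> \<le> cp $ k"
  shows "y + \<delta> *\<^sub>R w k \<in> spring_face I K"
proof -
  have kJ: "k \<in> J" using k J by blast
  have st: "stress j (y + \<delta> *\<^sub>R w k) = stress j y + (if j = k then \<delta> else 0)" if "j \<in> J" for j
    using stress_w[OF kJ that] by (simp add: stress_simps)
  have "y + \<delta> *\<^sub>R w k \<in> V"
    using V y w_mem[OF kJ] by (simp add: spring_face_def subspace_add subspace_scale)
  moreover have "stress j (y + \<delta> *\<^sub>R w k) = elastic_limit cm cp \<alpha> j" if "(\<alpha>, j) \<in> I" for \<alpha> j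
  proof -
    have "j \<in> snd ` I" using that by force
    then have "j \<noteq> k" "j \<in> J" using disj k J by auto
    then show ?thesis using st[of j] y that by (auto simp: spring_face_def)
  qed
  moreover have "cm $ j \<le> stress j (y + \<delta> *\<^sub>R w k) \<and> stress j (y + \<delta> *\<^sub>R w k) \<le> cp $ j" if "j \<in> K" for j
    using st[of j] y that \<delta> J by (auto simp: spring_face_def)
  ultimately show ?thesis by (auto simp: spring_face_def)
qed

text \<open>In the frame dual to the stresses of the springs in \<open>J\<close>, the normal cone of a face consists of
  the vectors with coefficients of the right sign on \<open>K\<close> and arbitrary ones on \<open>I\<close>. Adding \<open>g\<close>
  repairs the signs on \<open>I\<close> as long as the perturbation is small.\<close>
lemma perturbed_normal_cone:
  assumes I: "I \<subseteq> {- 1, 1} \<times> UNIV" and J: "J = snd ` I \<union> K"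
    and g: "g \<in> V" and g_I: "\<And>\<alpha> j. (\<alpha>, j) \<in> I \<Longrightarrow> \<alpha> * (g \<bullet> (diag_matrix a *v w j)) > 0"
    and g_K: "\<And>j. j \<in> K \<Longrightarrow> g \<bullet> (diag_matrix a *v w j) = 0"
    and disj: "snd ` I \<inter> K = {}" and sub: "spring_face I K \<subseteq> elastic_set"
  shows "\<exists>\<epsilon>>0. \<forall>y\<in>spring_face I K.
    \<forall>v\<in>ball_A V (diag_matrix a) \<epsilon> \<inter> normal_cone_A V (diag_matrix a) (spring_face I K) y.
      g + v \<in> normal_cone_A V (diag_matrix a) elastic_set y"
proof -
  let ?A = "diag_matrix a"
  define N where "N j = norm_A ?A (w j)" for j
  have N0: "N j \<ge> 0" for j by (simp add: N_def flip: norm_sqrt_scale[OF a_pos])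
  \<comment> \<open>By Cauchy-Schwarz a vector of norm at most \<open>r j\<close> has a
    \<open>j\<close>-th coefficient no larger in modulus than that of \<open>g\<close>. The 1 keeps
    the denominator positive.\<close>
  define r where "r j = \<bar>g \<bullet> (?A *v w j)\<bar> / (1 + N j)" for j
  \<comment> \<open>The inserted 1 gives the minimum a value when \<open>I\<close> is empty.\<close>
  define \<epsilon> where "\<epsilon> = Min (insert 1 (r ` snd ` I))"
  have r: "r j > 0" if "j \<in> snd ` I" for j
    using that g_I N0[of j] by (force simp: r_def intro!: divide_pos_pos add_pos_nonneg)
  have "\<epsilon> > 0" using r by (simp add: \<epsilon>_def)
  have small: "\<epsilon> * N j \<le> \<bar>g \<bullet> (?A *v w j)\<bar>" if "j \<in> snd ` I" for j
  proof -
    have "\<epsilon> \<le> r j" using that by (simp add: \<epsilon>_def)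
    then have "\<epsilon> * (1 + N j) \<le> \<bar>g \<bullet> (?A *v w j)\<bar>"
      using N0[of j] by (simp add: r_def pos_le_divide_eq add_pos_nonneg)
    then show ?thesis using \<open>\<epsilon> > 0\<close> by (simp add: algebra_simps)
  qed
  have "g + v \<in> normal_cone_A V ?A elastic_set y"
    if y: "y \<in> spring_face I K" and v: "v \<in> ball_A V ?A \<epsilon>" "v \<in> normal_cone_A V ?A (spring_face I K) y" for y v
  proof -
    have yV: "y \<in> V" and yC: "y \<in> elastic_set" using y sub by (auto simp: spring_face_def)
    have vV: "v \<in> V" and v\<epsilon>: "norm_A ?A v \<le> \<epsilon>" using v(1) by (auto simp: ball_A_def)
    have vN: "v \<bullet> (?A *v (\<xi> - y)) \<le> 0" if "\<xi> \<in> spring_face I K" for \<xi>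
      using v(2) y that by (simp add: normal_cone_A_def)
    have move: "\<delta> * (v \<bullet> (?A *v w k)) \<le> 0"
      if k: "k \<in> K" and \<delta>: "cm $ k \<le> stress k y + \<delta>" "stress k y + \<delta> \<le> cp $ k" for k \<delta>
    proof -
      have "y + \<delta> *\<^sub>R w k \<in> spring_face I K" by (rule spring_face_move[OF J disj y k \<delta>])
      from vN[OF this] show ?thesis by (simp add: matrix_vector_mult_scaleR)
    qed
    have "(g + v) \<bullet> (?A *v (\<xi> - y)) \<le> 0" if \<xi>: "\<xi> \<in> elastic_set" for \<xi>
    proof -
      have "\<xi> - y \<in> V" using \<xi> yV V by (simp add: elastic_set_def subspace_diff)
      then have "(g + v) \<bullet> (?A *v (\<xi> - y))
          = (\<Sum>j\<in>J. (stress j \<xi> - stress j y) * ((g + v) \<bullet> (?A *v w j)))"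
        by (simp add: inner_expand stress_simps)
      also have "\<dots> \<le> 0"
      proof (rule sum_nonpos)
        fix j assume "j \<in> J"
        have \<xi>j: "cm $ j \<le> stress j \<xi>" "stress j \<xi> \<le> cp $ j" using \<xi> by (auto simp: elastic_set_def)
        show "(stress j \<xi> - stress j y) * ((g + v) \<bullet> (?A *v w j)) \<le> 0"
        proof (cases "j \<in> K")
          case True
          define s where "s = v \<bullet> (?A *v w j)"
          have lim: "cm $ j \<le> stress j y" "stress j y \<le> cp $ j" using y True by (auto simp: spring_face_def)
          \<comment> \<open>Since \<open>\<xi>\<close> obeys the limits of spring \<open>j\<close>,
            moving the \<open>j\<close>-th stress of \<open>y\<close> to that of
            \<open>\<xi>\<close> stays inside the face.\<close>
          have "(stress j \<xi> - stress j y) * s \<le> 0"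
            using move[OF True, of "stress j \<xi> - stress j y"] \<xi>j by (simp add: s_def)
          then show ?thesis using g_K[OF True] by (simp add: inner_add_left s_def)
        next
          case False
          then have jI: "j \<in> snd ` I" using J \<open>j \<in> J\<close> by blast
          then obtain \<alpha> where \<alpha>: "(\<alpha>, j) \<in> I" by force
          have "\<bar>v \<bullet> (?A *v w j)\<bar> \<le> norm_A ?A v * N j"
            using Cauchy_Schwarz_ineq2[of "sqrt_scale a v" "sqrt_scale a (w j)"]
            by (simp add: inner_sqrt_scale[OF a_pos] norm_sqrt_scale[OF a_pos] N_def)
          also have "\<dots> \<le> \<epsilon> * N j" using v\<epsilon> N0 by (rule mult_right_mono)
          also have "\<dots> \<le> \<bar>g \<bullet> (?A *v w j)\<bar>" by (rule small[OF jI])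
          finally have dom: "\<bar>v \<bullet> (?A *v w j)\<bar> \<le> \<bar>g \<bullet> (?A *v w j)\<bar>" .
          \<comment> \<open>The stress of \<open>y\<close> is at the limit selected by
            \<open>\<alpha>\<close>, so the stress difference has the sign of
            \<open>-\<alpha>\<close> or vanishes, whereas by \<open>dom\<close> the coefficient of
            \<open>g + v\<close> has the sign of \<open>\<alpha>\<close> or vanishes.\<close>
          have yj: "stress j y = elastic_limit cm cp \<alpha> j" using y \<alpha> by (auto simp: spring_face_def)
          have "\<alpha> = 1 \<or> \<alpha> = -1" using I \<alpha> by auto
          then show ?thesis
          proof
            assume "\<alpha> = 1"
            then have "0 \<le> (g + v) \<bullet> (?A *v w j)" "stress j \<xi> \<le> stress j y"
              using dom g_I[OF \<alpha>] \<xi>j yj by (auto simp: inner_add_left elastic_limit_def)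
            then show ?thesis by (simp add: mult_nonpos_nonneg)
          next
            assume "\<alpha> = -1"
            then have "(g + v) \<bullet> (?A *v w j) \<le> 0" "stress j y \<le> stress j \<xi>"
              using dom g_I[OF \<alpha>] \<xi>j yj by (auto simp: inner_add_left elastic_limit_def)
            then show ?thesis by (simp add: mult_nonneg_nonpos)
          qed
        qed
      qed
      finally show ?thesis .
    qed
    then show ?thesis using yC g vV V by (simp add: normal_cone_A_def subspace_add)
  qed
  then show ?thesis using \<open>\<epsilon> > 0\<close> by blast
qed

lemma face_vertexI:
  assumes "y \<in> V" and "J = snd ` I" and "\<forall>(\<alpha>, j)\<in>I. stress j y = elastic_limit cm cp \<alpha> j"
  shows "face_vertex V (diag_matrix a) cm cp I = y"
  unfolding face_vertex_def
proof (rule the_equality)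
  fix z assume z: "z \<in> V \<and> (\<forall>(\<alpha>, j)\<in>I. axis j 1 \<bullet> (diag_matrix a *v z) = elastic_limit cm cp \<alpha> j)"
  have "stress j z = stress j y" if "j \<in> J" for j
    using that z assms(2,3) by (force simp: stress_def)
  then show "z = y" using eq_of_stress_eq z assms(1) by blast
qed (use assms in \<open>auto simp: stress_def\<close>)

text \<open>The dual basis writes the vertex down explicitly; injectivity of \<open>snd\<close>
  ensures that no spring is assigned two limits.\<close>

lemma face_vertex_exists:
  assumes "J = snd ` I" "inj_on snd I"
  shows "face_vertex V (diag_matrix a) cm cp I \<in> V"
    and "\<forall>(\<alpha>, j)\<in>I. stress j (face_vertex V (diag_matrix a) cm cp I) = elastic_limit cm cp \<alpha> j"
proof -
  define y where "y = (\<Sum>(\<alpha>, j)\<in>I. elastic_limit cm cp \<alpha> j *\<^sub>R w j)"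
  have wV: "w j \<in> V" if "(\<alpha>, j) \<in> I" for \<alpha> j using that w_mem assms(1) by force
  have yV: "y \<in> V"
    unfolding y_def using V by (auto intro!: subspace_sum subspace_scale wV)
  have "finite I" using assms finite_imageD[of snd I] by simp
  have st: "stress j y = elastic_limit cm cp \<alpha> j" if "(\<alpha>, j) \<in> I" for \<alpha> j
  proof -
    have "stress j y = (\<Sum>p\<in>I. if p = (\<alpha>, j) then elastic_limit cm cp (fst p) (snd p) else 0)"
      unfolding y_def linear_sum[OF linear_stress]
    proof (rule sum.cong[OF refl], clarify)
      fix \<beta> k assume k: "(\<beta>, k) \<in> I"
      have "k \<in> J" "j \<in> J" using k that assms(1) by force+
      moreover have "(\<beta>, k) = (\<alpha>, j) \<longleftrightarrow> k = j"
        using inj_onD[OF assms(2) _ k that] by auto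
      ultimately show "stress j (elastic_limit cm cp \<beta> k *\<^sub>R w k) =
          (if (\<beta>, k) = (\<alpha>, j) then elastic_limit cm cp (fst (\<beta>, k)) (snd (\<beta>, k)) else 0)"
        using stress_w[of k j] by (simp add: stress_simps)
    qed
    then show ?thesis using that \<open>finite I\<close> by simp
  qed
  then have "face_vertex V (diag_matrix a) cm cp I = y"
    using yV assms(1) by (intro face_vertexI) auto
  then show "face_vertex V (diag_matrix a) cm cp I \<in> V"
    and "\<forall>(\<alpha>, j)\<in>I. stress j (face_vertex V (diag_matrix a) cm cp I) = elastic_limit cm cp \<alpha> j"
    using yV st by auto
qed

end

lemma snd_sign_changes:
  assumes "I \<in> sign_changes I1"
  shows "snd ` I = snd ` I1"
proof -
  obtain T where T: "T \<subseteq> I1" "I = (I1 - T) \<union> (\<lambda>(\<alpha>, j). (- \<alpha>, j)) ` T"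
    using assms by (auto simp: sign_changes_def)
  have "snd ` (\<lambda>(\<alpha>, j). (- \<alpha>, j)) ` T = snd ` T" by (force simp: image_image case_prod_unfold)
  then show ?thesis using T by (auto simp: image_Un)
qed

context elastic_frame
begin

text \<open>By Krein-Milman the compact face is the hull of its extreme points. At such a point no
  stress of a spring of \<open>I1\<close> lies strictly between its limits, so the point is the
  vertex of some sign pattern.\<close>

lemma spring_face_subset_convex_hull:
  assumes I0: "I0 \<subseteq> {- 1, 1} \<times> UNIV" and I1: "I1 \<subseteq> {- 1, 1} \<times> UNIV"
    and J: "J = snd ` I0 \<union> snd ` I1" and disj: "snd ` I0 \<inter> snd ` I1 = {}"
  shows "spring_face I0 (snd ` I1)
    \<subseteq> convex hull ((\<lambda>I. face_vertex V (diag_matrix a) cm cp (I0 \<union> I)) ` sign_changes I1)"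
    (is "?F \<subseteq> convex hull ?S")
proof -
  have "norm y \<le> (\<Sum>j\<in>J. (\<bar>cm $ j\<bar> + \<bar>cp $ j\<bar>) * norm (w j))" if y: "y \<in> ?F" for y
  proof -
    have "y = (\<Sum>j\<in>J. stress j y *\<^sub>R w j)" using y expand by (simp add: spring_face_def)
    then have "norm y \<le> (\<Sum>j\<in>J. norm (stress j y *\<^sub>R w j))" by (metis norm_sum)
    also have "\<dots> \<le> (\<Sum>j\<in>J. (\<bar>cm $ j\<bar> + \<bar>cp $ j\<bar>) * norm (w j))"
    proof (rule sum_mono)
      fix j assume "j \<in> J"
      have "\<bar>stress j y\<bar> \<le> \<bar>cm $ j\<bar> + \<bar>cp $ j\<bar>"
      proof (cases "j \<in> snd ` I1")
        case True
        then have "cm $ j \<le> stress j y" "stress j y \<le> cp $ j" using y by (auto simp: spring_face_def)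
        then show ?thesis by simp
      next
        case False
        then obtain \<alpha> where "(\<alpha>, j) \<in> I0" using J \<open>j \<in> J\<close> by force
        then have "stress j y = elastic_limit cm cp \<alpha> j" using y by (auto simp: spring_face_def)
        then show ?thesis by (simp add: elastic_limit_def)
      qed
      then show "norm (stress j y *\<^sub>R w j) \<le> (\<bar>cm $ j\<bar> + \<bar>cp $ j\<bar>) * norm (w j)"
        by (simp add: mult_right_mono)
    qed
    finally show ?thesis .
  qed
  then have "bounded ?F" by (auto simp: bounded_iff)
  then have "compact ?F" using closed_spring_face compact_eq_bounded_closed by blast
  then have "?F = convex hull {y. y extreme_point_of ?F}"
    using Krein_Milman_Minkowski convex_spring_face by blast
  also have "\<dots> \<subseteq> convex hull ?S"
  proof (rule hull_mono, rule subsetI)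
    fix y assume "y \<in> {y. y extreme_point_of ?F}"
    then have y: "y \<in> ?F" and ext: "\<And>p q. p \<in> ?F \<Longrightarrow> q \<in> ?F \<Longrightarrow> y \<notin> open_segment p q"
      by (auto simp: extreme_point_of_def)
    have lim: "stress k y = cm $ k \<or> stress k y = cp $ k" if k: "k \<in> snd ` I1" for k
    proof (rule ccontr)
      assume neg: "\<not> ?thesis"
      \<comment> \<open>The distance to the nearer limit, so that both moves by
        \<open>\<delta>\<close> and \<open>-\<delta>\<close> along \<open>w k\<close> remain in the
        face and have \<open>y\<close> as midpoint.\<close>
      define \<delta> where "\<delta> = min (stress k y - cm $ k) (cp $ k - stress k y)"
      have "cm $ k \<le> stress k y" "stress k y \<le> cp $ k" using y k by (auto simp: spring_face_def)
      then have "\<delta> > 0" using neg by (auto simp: \<delta>_def)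
      have bounds: "cm $ k \<le> stress k y - \<delta>" "stress k y + \<delta> \<le> cp $ k" by (auto simp: \<delta>_def)
      have mem: "y + \<delta> *\<^sub>R w k \<in> ?F" "y + (- \<delta>) *\<^sub>R w k \<in> ?F"
        using \<open>\<delta> > 0\<close> bounds by (auto intro!: spring_face_move[OF J disj y k] simp del: scaleR_minus_left)
      have "w k \<noteq> 0"
        using stress_w[of k k] k J linear_0[OF linear_stress] by force
      then have ne: "y + \<delta> *\<^sub>R w k \<noteq> y + (- \<delta>) *\<^sub>R w k"
        using \<open>\<delta> > 0\<close> by (simp del: scaleR_minus_left)
      have "midpoint (y + \<delta> *\<^sub>R w k) (y + (- \<delta>) *\<^sub>R w k) \<in> open_segment (y + \<delta> *\<^sub>R w k) (y + (- \<delta>) *\<^sub>R w k)"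
        using ne by (simp only: midpoint_in_open_segment not_False_eq_True)
      moreover have "midpoint (y + \<delta> *\<^sub>R w k) (y + (- \<delta>) *\<^sub>R w k) = y"
        by (simp add: midpoint_def algebra_simps flip: scaleR_2)
      ultimately show False using ext[OF mem] by metis
    qed
    \<comment> \<open>Exactly the elements of \<open>I1\<close> whose limit is not attained at
      \<open>y\<close>; there \<open>y\<close> attains the opposite limit, so these signs are
      flipped.\<close>
    define T where "T = {(\<alpha>, j) \<in> I1. stress j y \<noteq> elastic_limit cm cp \<alpha> j}"
    define I' where "I' = (I1 - T) \<union> (\<lambda>(\<alpha>, j). (- \<alpha>, j)) ` T"
    have I': "I' \<in> sign_changes I1" by (auto simp: sign_changes_def I'_def T_def)
    have "stress j y = elastic_limit cm cp \<alpha> j" if \<alpha>j: "(\<alpha>, j) \<in> I0 \<union> I'" for \<alpha> j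
    proof -
      consider "(\<alpha>, j) \<in> I0" | "(\<alpha>, j) \<in> I1 - T" | "(- \<alpha>, j) \<in> T"
        using \<alpha>j by (force simp: I'_def)
      then show ?thesis
      proof cases
        case 1
        then show ?thesis using y by (auto simp: spring_face_def)
      next
        case 2
        then show ?thesis by (auto simp: T_def)
      next
        case 3
        then have "(- \<alpha>, j) \<in> I1" "stress j y \<noteq> elastic_limit cm cp (- \<alpha>) j" by (auto simp: T_def)
        moreover from this have "\<alpha> = 1 \<or> \<alpha> = -1" using I1 by (auto simp: minus_equation_iff)
        moreover have "stress j y = cm $ j \<or> stress j y = cp $ j"
          using lim[of j] \<open>(- \<alpha>, j) \<in> I1\<close> by force
        ultimately show ?thesis by (auto simp: elastic_limit_def)
      qed
    qed
    then have "face_vertex V (diag_matrix a) cm cp (I0 \<union> I') = y"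
      using y J snd_sign_changes[OF I'] by (intro face_vertexI) (auto simp: spring_face_def image_Un)
    then show "y \<in> ?S" using I' by blast
  qed
  finally show ?thesis .
qed

text \<open>Subtracting \<open>c\<close> freezes the moving set, and \<open>sqrt_scale\<close> turns
  the problem into Euclidean attraction. The required decrease of the distance comes from testing
  the two normal cone inclusions against each other.\<close>

lemma sweeping_eventually_in:
  assumes F: "closed F" "convex F" "F \<noteq> {}" "F \<subseteq> C" and C: "C \<subseteq> V" and "\<epsilon> > 0"
    and incl: "\<And>p v. p \<in> F \<Longrightarrow> v \<in> ball_A V (diag_matrix a) \<epsilon> \<inter> normal_cone_A V (diag_matrix a) F p \<Longrightarrow>
       g + v \<in> normal_cone_A V (diag_matrix a) C p"
    and c': "\<And>t. t > 0 \<Longrightarrow> (c has_vector_derivative - g) (at t)"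
    and cL: "\<And>s t. 0 \<le> s \<Longrightarrow> s \<le> t \<Longrightarrow> norm (c t - c s) \<le> L * (t - s)" "L \<ge> 0"
    and sol: "sweeping_solution V (diag_matrix a) (\<lambda>t. (\<lambda>x. x + c t) ` C) y"
  shows "\<forall>\<^sub>F \<tau> in at_top. y \<tau> \<in> (\<lambda>x. x + c \<tau>) ` F"
proof -
  let ?A = "diag_matrix a" and ?B = "sqrt_scale a"
  define u where "u t = ?B (y t - c t)" for t
  have blin: "bounded_linear ?B" using linear_sqrt_scale linear_conv_bounded_linear by blast
  obtain K where K: "K > 0" "\<And>x. norm (?B x) \<le> norm x * K"
    using bounded_linear.pos_bounded[OF blin] by blast
  have ac: "abs_continuous_on {0..\<tau>} u" if "\<tau> > 0" for \<tau>
  proof (rule abs_continuous_on_dominated[where K = K and K' = "K * L"])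
    show "abs_continuous_on {0..\<tau>} y" using sol that by (simp add: sweeping_solution_def)
    fix s t assume st: "s \<in> {0..\<tau>}" "t \<in> {0..\<tau>}" "s \<le> t"
    have "u t - u s = ?B ((y t - y s) - (c t - c s))"
      by (simp add: u_def linear_diff[OF linear_sqrt_scale])
    then have "norm (u t - u s) \<le> norm ((y t - y s) - (c t - c s)) * K" using K(2) by metis
    also have "\<dots> \<le> (norm (y t - y s) + L * (t - s)) * K"
      using norm_triangle_ineq4[of "y t - y s" "c t - c s"] cL(1)[of s t] st K(1)
      by (intro mult_right_mono) auto
    finally show "norm (u t - u s) \<le> K * norm (y t - y s) + K * L * (t - s)"
      by (simp add: algebra_simps)
  qed (use K cL in auto)
  have F': "closed (?B ` F)" "convex (?B ` F)" "?B ` F \<noteq> {}"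
    using F closed_injective_linear_image[OF F(1) linear_sqrt_scale inj_sqrt_scale[OF a_pos]]
      convex_linear_image[OF linear_sqrt_scale F(2)] by auto
  have "\<forall>\<^sub>F \<tau> in at_top. u \<tau> \<in> ?B ` F"
  proof (rule eventually_mem_of_attraction[OF F' \<open>\<epsilon> > 0\<close> ac])
    \<comment> \<open>The derivative of \<open>c\<close> is given only for positive times; the point
      0 is discarded as a null set.\<close>
    have "AE t in lebesgue. t \<noteq> (0::real)"
      by (rule AE_I'[of "{0}"]) (auto simp: negligible_iff_null_sets[symmetric])
    moreover have "AE t in lebesgue. 0 \<le> t \<longrightarrow>
        (\<exists>y'. (y has_vector_derivative y') (at t) \<and> - y' \<in> normal_cone_A V ?A ((\<lambda>x. x + c t) ` C) (y t))"
      using sol by (simp add: sweeping_solution_def)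
    ultimately show "AE t in lebesgue. 0 \<le> t \<longrightarrow> (\<exists>u'. (u has_vector_derivative u') (at t) \<and>
       u' \<bullet> (u t - closest_point (?B ` F) (u t)) \<le> - \<epsilon> * norm (u t - closest_point (?B ` F) (u t)))"
    proof eventually_elim
      case (elim t)
      show ?case
      proof
        assume "0 \<le> t"
        with elim obtain y' where y': "(y has_vector_derivative y') (at t)"
          and ny: "- y' \<in> normal_cone_A V ?A ((\<lambda>x. x + c t) ` C) (y t)" and "t > 0" by auto
        define x where "x = y t - c t"
        have "y t \<in> (\<lambda>x. x + c t) ` C" using ny by (auto simp: normal_cone_A_def split: if_splits)
        then have xC: "x \<in> C" by (auto simp: x_def)
        have u': "(u has_vector_derivative ?B (y' + g)) (at t)"
          unfolding u_def using has_vector_derivative_diff[OF y' c'[OF \<open>t > 0\<close>]]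
            bounded_linear.has_vector_derivative[OF blin] by fastforce
        obtain p where p: "p \<in> F" "closest_point (?B ` F) (u t) = ?B p"
          using closest_point_in_set[OF F'(1,3)] by blast
        define n where "n = norm (u t - ?B p)"
        have ux: "u t - ?B p = ?B (x - p)" by (simp add: u_def x_def linear_diff[OF linear_sqrt_scale])
        have "?B (y' + g) \<bullet> (u t - ?B p) \<le> - \<epsilon> * n"
        proof (cases "n = 0")
          case True
          then show ?thesis by (simp add: n_def)
        next
          case False
          then have "n > 0" by (simp add: n_def)
          define q where "q = (\<epsilon> / n) *\<^sub>R (x - p)"
          have qV: "q \<in> V"
            unfolding q_def using V xC p(1) F(4) C by (intro subspace_scale subspace_diff) auto
          have Bq: "?B q = (\<epsilon> / n) *\<^sub>R (u t - ?B p)"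
            unfolding q_def ux by (rule linear_cmul[OF linear_sqrt_scale])
          have "norm_A ?A q \<le> \<epsilon>"
            using \<open>n > 0\<close> \<open>\<epsilon> > 0\<close> by (simp add: Bq n_def[symmetric] flip: norm_sqrt_scale[OF a_pos])
          moreover have "q \<bullet> (?A *v (\<xi> - p)) \<le> 0" if "\<xi> \<in> F" for \<xi>
          proof -
            have "q \<bullet> (?A *v (\<xi> - p)) = (\<epsilon> / n) * ((u t - ?B p) \<bullet> (?B \<xi> - ?B p))"
              by (simp add: Bq linear_diff[OF linear_sqrt_scale] flip: inner_sqrt_scale[OF a_pos])
            moreover have "(u t - ?B p) \<bullet> (?B \<xi> - ?B p) \<le> 0"
              using closest_point_dot[OF F'(2,1), of "?B \<xi>" "u t"] that p(2) by simp
            ultimately show ?thesis using \<open>n > 0\<close> \<open>\<epsilon> > 0\<close> by (simp add: divide_nonpos_pos mult_nonneg_nonpos)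
          qed
          ultimately have "g + q \<in> normal_cone_A V ?A C p"
            using incl[OF p(1)] qV p(1) by (simp add: ball_A_def normal_cone_A_def)
          then have "(g + q) \<bullet> (?A *v (x - p)) \<le> 0"
            using xC by (auto simp: normal_cone_A_def split: if_splits)
          \<comment> \<open>The sweeping inclusion is tested with \<open>p + c t\<close>, a point of
            the moving set because \<open>F \<subseteq> C\<close>.\<close>
          moreover have "- y' \<bullet> (?A *v ((p + c t) - y t)) \<le> 0"
            using ny p(1) F(4) by (auto simp: normal_cone_A_def split: if_splits)
          then have "y' \<bullet> (?A *v (x - p)) \<le> 0"
          proof -
            have "(p + c t) - y t = - (x - p)" by (simp add: x_def)
            then show ?thesis using \<open>- y' \<bullet> (?A *v ((p + c t) - y t)) \<le> 0\<close>
              by (simp only: linear_neg[OF matrix_vector_mul_linear] inner_minus_left inner_minus_right minus_minus)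
          qed
          moreover have "q \<bullet> (?A *v (x - p)) = \<epsilon> * n"
            using \<open>n > 0\<close> by (simp add: Bq ux[symmetric] n_def power2_norm_eq_inner[symmetric] power2_eq_square
                flip: inner_sqrt_scale[OF a_pos])
          moreover have "?B (y' + g) \<bullet> (u t - ?B p) = y' \<bullet> (?A *v (x - p)) + g \<bullet> (?A *v (x - p))"
            by (simp add: ux inner_sqrt_scale[OF a_pos] inner_add_left)
          ultimately show ?thesis by (simp add: inner_add_left)
        qed
        then show "\<exists>u'. (u has_vector_derivative u') (at t) \<and>
           u' \<bullet> (u t - closest_point (?B ` F) (u t)) \<le> - \<epsilon> * norm (u t - closest_point (?B ` F) (u t))"
          using u' p(2) by (auto simp: n_def)
      qed
    qed
  qed
  then show ?thesis
  proof eventually_elim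
    case (elim \<tau>)
    then have "y \<tau> - c \<tau> \<in> F"
      using inj_image_mem_iff[OF inj_sqrt_scale[OF a_pos]] by (simp add: u_def)
    then show ?case by (intro image_eqI[of _ _ "y \<tau> - c \<tau>"]) auto
  qed
qed

end

section \<open>Finite-time stability of a face\<close>

text \<open>Full rank forces the faces to involve \<open>d\<close> different springs. Their stresses
  separate points of \<open>V\<close>: modulo the kernel of \<open>P\<close>, any \<open>y\<close>
  in \<open>V\<close> is a combination of the corresponding unit vectors, so if these stresses
  vanish, \<open>y\<close> is orthogonal to itself.\<close>

lemma elastic_frame_of_spanning_faces:
  fixes P :: "real^'m^'d" and V :: "(real^'m) set"
  assumes a_pos: "\<forall>j. a $ j > 0" and V: "subspace V" "dim V = CARD('d)"
    and orth: "\<And>x y. P *v x = 0 \<Longrightarrow> y \<in> V \<Longrightarrow> x \<bullet> (diag_matrix a *v y) = 0"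
    and I: "finite I" "card I \<le> CARD('d)" "dim ((*v) P ` face_vectors I) = CARD('d)"
  obtains w where "elastic_frame V a (snd ` I) w" "inj_on snd I"
proof -
  define J where "J = snd ` I"
  \<comment> \<open>Signs do not affect spans, so the images of the unsigned unit vectors already
    have dimension \<open>d\<close>; this pins down the cardinalities of \<open>J\<close> and
    \<open>I\<close>.\<close>
  define E where "E = (\<lambda>j. axis j (1::real) :: real^'m) ` J"
  have "(*v) P ` face_vectors I \<subseteq> span ((*v) P ` E)"
  proof
    fix x assume "x \<in> (*v) P ` face_vectors I"
    then obtain \<alpha> j where "(\<alpha>, j) \<in> I" "x = \<alpha> *\<^sub>R (P *v axis j 1)"
      by (auto simp: face_vectors_def matrix_vector_mult_scaleR)
    moreover from this have "P *v axis j 1 \<in> (*v) P ` E" by (force simp: E_def J_def)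
    ultimately show "x \<in> span ((*v) P ` E)" by (simp add: span_scale span_base)
  qed
  then have "CARD('d) \<le> dim ((*v) P ` E)"
    using I(3) dim_subset[of "(*v) P ` face_vectors I" "span ((*v) P ` E)"] by simp
  also have "dim ((*v) P ` E) \<le> card J"
    unfolding E_def image_image by (meson card_image_le dim_le_card' finite finite_imageI le_trans)
  finally have "card J = CARD('d)" "card J = card I"
    using I card_image_le[OF I(1), of snd] by (auto simp: J_def)
  then have inj: "inj_on snd I" by (simp add: J_def I(1) eq_card_imp_inj_on)
  have full: "span ((*v) P ` E) = UNIV"
    using \<open>CARD('d) \<le> dim ((*v) P ` E)\<close> dim_subset_UNIV_cart[of "(*v) P ` E"]
    by (simp add: dim_eq_full[symmetric])
  have lin: "linear (\<lambda>y. axis j 1 \<bullet> (diag_matrix a *v y))" for j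
    by (rule linearI) (simp_all add: matrix_vector_right_distrib inner_add_right matrix_vector_mult_scaleR)
  have "y = 0" if y: "y \<in> V" "\<forall>j\<in>J. axis j 1 \<bullet> (diag_matrix a *v y) = 0" for y
  proof -
    have "P *v y \<in> (*v) P ` span E"
      using full by (simp add: linear_span_image[OF matrix_vector_mul_linear])
    then obtain x where x: "x \<in> span E" "P *v y = P *v x" by blast
    \<comment> \<open>\<open>y\<close> is split as \<open>x + (y - x)\<close>: the first part is
      orthogonal to \<open>y\<close> by the vanishing stresses, the second because it lies in the
      kernel of \<open>P\<close>.\<close>
    have "x \<bullet> (diag_matrix a *v y) = 0"
      using x(1) by (induction rule: span_induct) (use y in \<open>auto simp: subspace_def inner_add_left E_def\<close>)
    moreover have "(y - x) \<bullet> (diag_matrix a *v y) = 0"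
      using orth[of "y - x" y] x(2) y(1) by (simp add: matrix_vector_mult_diff_distrib)
    ultimately show ?thesis
      by (intro inner_diag_matrix_self_eq_0[OF a_pos]) (simp add: inner_diff_left)
  qed
  note sep = this
  show thesis
  proof (rule dual_frame_exists[of V J "\<lambda>j y. axis j 1 \<bullet> (diag_matrix a *v y)"])
    fix w :: "'m \<Rightarrow> real^'m"
    assume w: "\<And>j. j \<in> J \<Longrightarrow> w j \<in> V"
      "\<And>j k. j \<in> J \<Longrightarrow> k \<in> J \<Longrightarrow> axis k 1 \<bullet> (diag_matrix a *v w j) = (if k = j then 1 else 0)"
      "\<And>y. y \<in> V \<Longrightarrow> y = (\<Sum>j\<in>J. (axis j 1 \<bullet> (diag_matrix a *v y)) *\<^sub>R w j)"
    have "elastic_frame V a J w" by unfold_locales (fact a_pos V(1) w)+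
    then show thesis using that inj J_def by blast
  qed (use V \<open>card J = CARD('d)\<close> lin sep in auto)
qed

context elastic_frame
begin

text \<open>The frame coefficients of \<open>g\<close> are the signed positive weights on
  \<open>I0\<close> and vanish on \<open>K\<close>. These are the sign conditions under which
  \<open>perturbed_normal_cone\<close> gives the inclusion, and
  \<open>sweeping_eventually_in\<close> then gives the attraction.\<close>

lemma face_attraction:
  assumes I0: "I0 \<subseteq> {- 1, 1} \<times> UNIV" "inj_on snd I0" and J: "J = snd ` I0 \<union> K"
    and disj: "snd ` I0 \<inter> K = {}"
    and g: "g \<in> V" "\<And>y. y \<in> V \<Longrightarrow> g \<bullet> (diag_matrix a *v y) = (\<Sum>(\<alpha>, j)\<in>I0. q (\<alpha>, j) * (\<alpha> * stress j y))"
    and q: "\<forall>p\<in>I0. 0 < q p"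
    and face: "spring_face I0 K \<noteq> {}" "spring_face I0 K \<subseteq> elastic_set"
    and c': "\<And>t. t > 0 \<Longrightarrow> (c has_vector_derivative - g) (at t)"
    and cL: "\<And>s t. 0 \<le> s \<Longrightarrow> s \<le> t \<Longrightarrow> norm (c t - c s) \<le> L * (t - s)" "L \<ge> 0"
  shows "\<exists>\<epsilon>>0. \<forall>\<tau>>0. AE t in lebesgue. t \<in> {0..\<tau>} \<longrightarrow>
      (\<exists>c'. (c has_vector_derivative c') (at t) \<and>
        (\<forall>y\<in>spring_face I0 K. (\<lambda>x. - c' + x) ` (ball_A V (diag_matrix a) \<epsilon> \<inter>
            normal_cone_A V (diag_matrix a) (spring_face I0 K) y) \<subseteq> normal_cone_A V (diag_matrix a) elastic_set y))"
    and "sweeping_solution V (diag_matrix a) (\<lambda>t. (\<lambda>x. x + c t) ` elastic_set) y \<Longrightarrow>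
      \<forall>\<^sub>F \<tau> in at_top. y \<tau> \<in> (\<lambda>x. x + c \<tau>) ` spring_face I0 K"
proof -
  have fin: "finite I0" using I0(1) by (rule finite_subset) simp
  \<comment> \<open>The representation of \<open>g\<close> is evaluated at the dual vector
    \<open>w k\<close>, whose only nonzero stress in \<open>J\<close> is that of
    \<open>k\<close>.\<close>
  have gw: "g \<bullet> (diag_matrix a *v w k) = (\<Sum>p\<in>I0. if snd p = k then q p * fst p else 0)" if "k \<in> J" for k
    unfolding g(2)[OF w_mem[OF that]]
    by (rule sum.cong[OF refl]) (use J stress_w[OF that] in \<open>force simp: case_prod_unfold\<close>)
  have gI: "\<alpha> * (g \<bullet> (diag_matrix a *v w j)) > 0" if \<alpha>: "(\<alpha>, j) \<in> I0" for \<alpha> j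
  proof -
    have "j \<in> J" using \<alpha> J by force
    have "g \<bullet> (diag_matrix a *v w j) = (\<Sum>p\<in>I0. if p = (\<alpha>, j) then q p * fst p else 0)"
      unfolding gw[OF \<open>j \<in> J\<close>]
      by (rule sum.cong[OF refl]) (use \<alpha> inj_onD[OF I0(2)] in force)
    then have "g \<bullet> (diag_matrix a *v w j) = q (\<alpha>, j) * \<alpha>" using \<alpha> fin by simp
    moreover have "\<alpha> = 1 \<or> \<alpha> = -1" using \<alpha> I0(1) by auto
    ultimately show ?thesis using q \<alpha> by auto
  qed
  have gK: "g \<bullet> (diag_matrix a *v w j) = 0" if "j \<in> K" for j
  proof -
    have "j \<in> J" "\<forall>p\<in>I0. snd p \<noteq> j" using that J disj by auto
    then show ?thesis using gw[of j] by simp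
  qed
  obtain \<epsilon> where "\<epsilon> > 0" and \<epsilon>: "\<And>y v. y \<in> spring_face I0 K \<Longrightarrow>
      v \<in> ball_A V (diag_matrix a) \<epsilon> \<inter> normal_cone_A V (diag_matrix a) (spring_face I0 K) y \<Longrightarrow>
      g + v \<in> normal_cone_A V (diag_matrix a) elastic_set y"
    using perturbed_normal_cone[OF I0(1) J g(1) gI gK disj face(2)] by metis
  have pos: "AE t in lebesgue. t \<noteq> (0::real)"
    by (rule AE_I'[of "{0}"]) (auto simp: negligible_iff_null_sets[symmetric])
  show "\<exists>\<epsilon>>0. \<forall>\<tau>>0. AE t in lebesgue. t \<in> {0..\<tau>} \<longrightarrow>
      (\<exists>c'. (c has_vector_derivative c') (at t) \<and>
        (\<forall>y\<in>spring_face I0 K. (\<lambda>x. - c' + x) ` (ball_A V (diag_matrix a) \<epsilon> \<inter>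
            normal_cone_A V (diag_matrix a) (spring_face I0 K) y) \<subseteq> normal_cone_A V (diag_matrix a) elastic_set y))"
  proof (intro exI[of _ \<epsilon>] conjI allI impI \<open>\<epsilon> > 0\<close>)
    fix \<tau> :: real
    show "AE t in lebesgue. t \<in> {0..\<tau>} \<longrightarrow>
      (\<exists>c'. (c has_vector_derivative c') (at t) \<and>
        (\<forall>y\<in>spring_face I0 K. (\<lambda>x. - c' + x) ` (ball_A V (diag_matrix a) \<epsilon> \<inter>
            normal_cone_A V (diag_matrix a) (spring_face I0 K) y) \<subseteq> normal_cone_A V (diag_matrix a) elastic_set y))"
      using pos
    proof eventually_elim
      case (elim t)
      then show ?case using c'[of t] \<epsilon> by (intro impI exI[of _ "- g"]) auto
    qed
  qed
  show "\<forall>\<^sub>F \<tau> in at_top. y \<tau> \<in> (\<lambda>x. x + c \<tau>) ` spring_face I0 K"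
    if "sweeping_solution V (diag_matrix a) (\<lambda>t. (\<lambda>x. x + c t) ` elastic_set) y"
    using closed_spring_face convex_spring_face face _ \<open>\<epsilon> > 0\<close> \<epsilon> c' cL that
    by (rule sweeping_eventually_in) (auto simp: elastic_set_def)
qed

end

theorem proposition1:
  fixes D :: "real^'n^'m" and a cm cp R :: "real^'m" and l :: "real \<Rightarrow> real" and l' :: real
    and Q :: "nat \<Rightarrow> real^'n"
    and Vb :: "real^('k::finite option)^'m" and Dp :: "real^'k^'m"
    and d :: nat and A :: "real^'m^'m"
    and P :: "real^'m^('k option)" and W :: "real^('k option)^('k option)"
    and V :: "(real^'m) set" and c :: "real \<Rightarrow> real^'m"
    and L Lbar :: "real \<Rightarrow> 'm \<Rightarrow> (real^'m) set"
    and C :: "(real^'m) set" and Ct :: "real \<Rightarrow> (real^'m) set"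
    and I0 :: "(real \<times> 'm) set"
  assumes "CARD('m) \<ge> CARD('n)" and "CARD('n) \<ge> 2"
    and "CARD('k) = CARD('m) - CARD('n) + 1"
    and d_def: "d = CARD('m) - CARD('n) + 2"
    \<comment> \<open>the elastoplastic system\<close>
    and "connected_kinematic_matrix D" and "rank D = CARD('n) - 1"
    and "\<forall>j. a $ j > 0" and A_def: "A = diag_matrix a"
    and "\<forall>j. cm $ j \<le> cp $ j"
    and "rank (columnvector (transpose D *v R) :: real^1^'n) = 1"
    and "\<exists>K. K-lipschitz_on {0..} l"
    \<comment> \<open>the columns of the matrix \<open>Q\<close> are \<open>Q 0, \<dots>, Q (n - 3)\<close> (none if \<open>n = 2\<close>)\<close>
    and "dim ((\<lambda>i. D *v Q i) ` {..<CARD('n) - 2}) = CARD('n) - 2"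
    and "\<forall>i<CARD('n) - 2. R \<bullet> (D *v Q i) = 0"
    and "inj (\<lambda>i. column i Vb)" and "independent (columns Vb)"
    and "\<forall>i<CARD('n) - 2. \<forall>k. (D *v Q i) \<bullet> (A *v column k Vb) = 0"
    and "rank Dp = CARD('k)" and "transpose Dp ** D = 0"
    and P_def: "P = stacked_matrix R Dp"
    and W_def: "W = P ** Vb"
    and V_def: "V = range ((*v) Vb)"
    and c_def: "c = (\<lambda>t. - (l t *\<^sub>R (Vb *v (matrix_inv W *v axis None 1))))"
    and L_def: "L = (\<lambda>\<alpha> j. {y \<in> V. (\<alpha> *\<^sub>R axis j 1) \<bullet> (A *v y) \<le> \<alpha> * elastic_limit cm cp \<alpha> j})"
    and Lbar_def: "Lbar = (\<lambda>\<alpha> j. {y \<in> V. axis j 1 \<bullet> (A *v y) = elastic_limit cm cp \<alpha> j})"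
    and C_def: "C = {y \<in> V. \<forall>j. cm $ j \<le> axis j 1 \<bullet> (A *v y) \<and> axis j 1 \<bullet> (A *v y) \<le> cp $ j}"
    and Ct_def: "Ct = (\<lambda>t. (\<lambda>x. x + c t) ` C)"
    \<comment> \<open>constant loading rate and the family \<open>I0\<close>\<close>
    and "\<forall>t\<ge>0. (l has_real_derivative l') (at t within {0..})"
    and "I0 \<subseteq> {- 1, 1} \<times> UNIV"
    and "l' *\<^sub>R axis None 1 \<in> nonneg_cone ((*v) P ` face_vectors I0)"
    and "\<forall>p\<in>I0. l' *\<^sub>R axis None 1 \<notin> nonneg_cone ((*v) P ` face_vectors (I0 - {p}))"
    and "l' *\<^sub>R axis None 1 \<notin> rel_frontier (nonneg_cone ((*v) P ` face_vectors I0))"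
  shows
    "(\<forall>ystar F.
        card I0 = d \<and>
        ystar = face_vertex V A cm cp I0 \<and>
        F = {ystar} \<and>
        (\<forall>j. j \<notin> snd ` I0 \<longrightarrow> cm $ j < axis j 1 \<bullet> (A *v ystar) \<and> axis j 1 \<bullet> (A *v ystar) < cp $ j)
      \<longrightarrow>
        (\<exists>\<epsilon>>0. \<forall>\<tau>>0. AE t in lebesgue. t \<in> {0..\<tau>} \<longrightarrow>
           (\<exists>c'. (c has_vector_derivative c') (at t) \<and>
             (\<forall>y\<in>F. (\<lambda>x. - c' + x) ` (ball_A V A \<epsilon> \<inter> normal_cone_A V A F y) \<subseteq> normal_cone_A V A C y))) \<and>
        (\<forall>y. sweeping_solution V A Ct y \<and> y 0 \<in> Ct 0 \<longrightarrow>
           (\<forall>\<^sub>F \<tau> in at_top. y \<tau> \<in> (\<lambda>x. x + c \<tau>) ` F) \<and>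
           (\<forall>\<^sub>F \<tau> in at_top. A *v (y \<tau> - c \<tau>) = A *v ystar)))
     \<and>
     (\<forall>I M ystar F.
        card I0 < d \<and>
        I 1 \<subseteq> {- 1, 1} \<times> UNIV \<and>
        card I0 + card (I 1) = d \<and>
        dim ((*v) P ` face_vectors (I0 \<union> I 1)) = d \<and>
        M = 2 ^ (d - card I0) \<and>
        bij_betw I {1..M} (sign_changes (I (1::nat))) \<and>
        F = (\<Inter>(\<alpha>, j)\<in>I0. Lbar \<alpha> j) \<inter> (\<Inter>i\<in>{1..M}. \<Inter>(\<alpha>, j)\<in>I i. L \<alpha> j) \<and>
        (\<forall>i\<in>{1..M}. ystar i = face_vertex V A cm cp (I0 \<union> I i)) \<and>
        (\<forall>i\<in>{1..M}. \<forall>j. j \<notin> snd ` (I0 \<union> (\<Union>i\<in>{1..M}. I i)) \<longrightarrow>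
           cm $ j < axis j 1 \<bullet> (A *v ystar i) \<and> axis j 1 \<bullet> (A *v ystar i) < cp $ j) \<and>
        (\<forall>j \<in> snd ` (\<Union>i\<in>{1..M}. I i). cm $ j < cp $ j)
      \<longrightarrow>
        (\<exists>\<epsilon>>0. \<forall>\<tau>>0. AE t in lebesgue. t \<in> {0..\<tau>} \<longrightarrow>
           (\<exists>c'. (c has_vector_derivative c') (at t) \<and>
             (\<forall>y\<in>F. (\<lambda>x. - c' + x) ` (ball_A V A \<epsilon> \<inter> normal_cone_A V A F y) \<subseteq> normal_cone_A V A C y))) \<and>
        (\<forall>y. sweeping_solution V A Ct y \<and> y 0 \<in> Ct 0 \<longrightarrow>
           (\<forall>\<^sub>F \<tau> in at_top. y \<tau> \<in> (\<lambda>x. x + c \<tau>) ` F) \<and>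
           (\<forall>\<^sub>F \<tau> in at_top. A *v (y \<tau> - c \<tau>) \<in> convex hull ((\<lambda>i. A *v ystar i) ` {1..M}))))"
proof -
  have a_pos: "\<forall>j. a $ j > 0" and cmcp: "\<forall>j. cm $ j \<le> cp $ j" by fact+
  have inj: "inj (\<lambda>i. column i Vb)" and indep: "independent (columns Vb)" by fact+
  have QV: "\<forall>i<CARD('n) - 2. \<forall>k. (D *v Q i) \<bullet> (A *v column k Vb) = 0" by fact
  have l': "\<forall>t\<ge>0. (l has_real_derivative l') (at t within {0..})" by fact
  have I0: "I0 \<subseteq> {- 1, 1} \<times> UNIV" by fact
  have cone: "l' *\<^sub>R axis None 1 \<in> nonneg_cone ((*v) P ` face_vectors I0)" by fact
  have irr: "\<forall>p\<in>I0. l' *\<^sub>R axis None 1 \<notin> nonneg_cone ((*v) P ` face_vectors (I0 - {p}))" by fact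
  obtain KL where KL: "KL-lipschitz_on {0..} l" using \<open>\<exists>K. K-lipschitz_on {0..} l\<close> by blast
  have d: "d = CARD('k option)" using d_def \<open>CARD('k) = _\<close> by simp
  have finI0: "finite I0" using I0 by (rule finite_subset) simp

  \<comment> \<open>The kernel of \<open>P\<close> and its orthogonality to \<open>V\<close>\<close>
  have ker: "x \<in> span ((\<lambda>i. D *v Q i) ` {..<CARD('n) - 2})" if "P *v x = 0" for x
  proof -
    have "stacked_matrix R Dp *v x = 0" using that P_def by simp
    show ?thesis by (rule kernel_stacked_matrix[of D R Q Dp]) fact+
  qed
  have orth: "x \<bullet> (diag_matrix a *v y) = 0" if "P *v x = 0" "y \<in> V" for x y
    by (rule orthogonal_range_of_orthogonal_columns[OF _ ker[OF that(1)]])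
      (use QV that(2) in \<open>auto simp: A_def V_def\<close>)
  have Vb: "inj ((*v) Vb)" "dim V = CARD('k option)"
    using inj_mult_of_independent_columns[OF inj indep] by (simp_all add: V_def)
  have V: "subspace V" by (simp add: V_def linear_subspace_image)

  \<comment> \<open>Invertibility of \<open>W\<close>\<close>
  have "inj ((*v) W)"
  proof (rule linear_injective_0[OF matrix_vector_mul_linear, THEN iffD2], intro allI impI)
    fix z assume "W *v z = 0"
    then have "P *v (Vb *v z) = 0" by (simp add: W_def matrix_vector_mul_assoc)
    \<comment> \<open>This vector lies both in \<open>V\<close> and in the kernel of
      \<open>P\<close>, hence is orthogonal to itself.\<close>
    then have "Vb *v z = 0"
      using orth[of "Vb *v z" "Vb *v z"] inner_diag_matrix_self_eq_0[OF a_pos] by (simp add: V_def)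
    then show "z = 0" using injD[OF Vb(1), of z 0] by simp
  qed
  then have "invertible W"
    by (simp add: invertible_left_inverse matrix_left_invertible_injective)
  then have "W ** matrix_inv W = mat 1"
    unfolding invertible_def matrix_inv_def by (metis (mono_tags, lifting) someI_ex)
  then have WW: "W *v (matrix_inv W *v e) = e" for e by (simp add: matrix_vector_mul_assoc)

  \<comment> \<open>The loading rate as a combination of outer normals\<close>
  define b where "b = Vb *v (matrix_inv W *v axis None 1)"
  \<comment> \<open>The constant value of the negative derivative of \<open>c\<close>.\<close>
  define g where "g = l' *\<^sub>R b"
  have bV: "b \<in> V" by (simp add: b_def V_def)
  have gV: "g \<in> V" using bV V by (simp add: g_def subspace_scale)
  have Pg: "P *v g = l' *\<^sub>R axis None 1"
    using WW[of "axis None 1"] by (simp add: g_def b_def W_def matrix_vector_mult_scaleR matrix_vector_mul_assoc matrix_mul_assoc)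

  define f where "f = (\<lambda>(\<alpha>, j). \<alpha> *\<^sub>R axis j (1::real) :: real^'m)"
  have faces: "(*v) P ` face_vectors I = (\<lambda>p. P *v f p) ` I" for I
    unfolding face_vectors_image f_def by (rule image_cong) auto
  obtain q where q: "l' *\<^sub>R axis None 1 = (\<Sum>p\<in>I0. q p *\<^sub>R (P *v f p))" "\<forall>p\<in>I0. 0 \<le> q p"
    using cone unfolding faces nonneg_cone_image[OF finI0] by blast
  note irreducible = irreducible_conic_combination[OF finI0 q irr[unfolded faces]]
  have g_rep: "g \<bullet> (diag_matrix a *v y) = (\<Sum>(\<alpha>, j)\<in>I0. q (\<alpha>, j) * (\<alpha> * (axis j 1 \<bullet> (diag_matrix a *v y))))"
    if "y \<in> V" for y
  proof -
    \<comment> \<open>\<open>P\<close> has the same value on \<open>g\<close> and on the combination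
      of face vectors; their difference lies in its kernel, so both act alike on
      \<open>V\<close>.\<close>
    have "P *v (g - (\<Sum>p\<in>I0. q p *\<^sub>R f p)) = 0"
      by (simp add: matrix_vector_mult_diff_distrib Pg q(1) linear_sum[OF matrix_vector_mul_linear]
          matrix_vector_mult_scaleR)
    from orth[OF this that] have "g \<bullet> (diag_matrix a *v y) = (\<Sum>p\<in>I0. q p *\<^sub>R f p) \<bullet> (diag_matrix a *v y)"
      by (simp add: inner_diff_left)
    then show ?thesis by (simp add: inner_sum_left f_def case_prod_unfold mult.assoc)
  qed

  \<comment> \<open>Derivative and Lipschitz bound of \<open>c\<close>\<close>
  have c_eq: "c t = - (l t *\<^sub>R b)" for t by (simp add: c_def b_def)
  have c': "(c has_vector_derivative - g) (at t)" if "t > 0" for t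
  proof -
    have "(l has_real_derivative l') (at t within {0<..})"
      by (rule DERIV_subset[OF l'[rule_format]]) (use that in auto)
    then have "(l has_real_derivative l') (at t)"
      using that by (simp add: at_within_open[of t "{0<..}"])
    then show ?thesis
      unfolding c_def b_def[symmetric] g_def
      by (auto intro!: derivative_eq_intros simp: has_real_derivative_iff_has_vector_derivative)
  qed
  have cL: "norm (c t - c s) \<le> (KL * norm b) * (t - s)" if "0 \<le> s" "s \<le> t" for s t
  proof -
    have "c t - c s = (l s - l t) *\<^sub>R b" by (simp add: c_eq scaleR_diff_left)
    then have "norm (c t - c s) = \<bar>l s - l t\<bar> * norm b" by simp
    also have "\<dots> \<le> (KL * (t - s)) * norm b"
      using lipschitz_onD[OF KL, of s t] that by (intro mult_right_mono) (auto simp: dist_real_def)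
    finally show ?thesis by (simp add: mult_ac)
  qed
  have KL0: "KL * norm b \<ge> 0" using lipschitz_on_nonneg[OF KL] by simp

  show ?thesis
  proof (intro conjI allI impI; elim conjE)

    \<comment> \<open>The case \<open>card I0 = d\<close>: attraction to a vertex\<close>
    fix ystar :: "real^'m" and F
    assume card: "card I0 = d" and ystar: "ystar = face_vertex V A cm cp I0" and F: "F = {ystar}"
      and strict: "\<forall>j. j \<notin> snd ` I0 \<longrightarrow> cm $ j < axis j 1 \<bullet> (A *v ystar) \<and> axis j 1 \<bullet> (A *v ystar) < cp $ j"
    \<comment> \<open>Irreducibility makes the \<open>d\<close> images under \<open>P\<close>
      independent, so they span and yield a frame with \<open>K\<close> empty.\<close>
    have "dim ((*v) P ` face_vectors I0) = CARD('k option)"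
      using dim_image_of_independent_family[OF finI0 irreducible(2)] card d by (simp add: faces)
    then obtain w where "elastic_frame V a (snd ` I0) w" and injI: "inj_on snd I0"
      using elastic_frame_of_spanning_faces[OF a_pos V Vb(2) orth finI0] card d by auto
    then interpret elastic_frame V a cm cp "snd ` I0" w by simp
    note vertex = face_vertex_exists[OF refl injI, folded A_def, folded ystar]
    have Ceq: "C = elastic_set" by (simp add: C_def elastic_set_def stress_def A_def)
    have Feq: "F = spring_face I0 {}"
    proof -
      have "x = ystar" if x: "x \<in> V" "\<forall>(\<alpha>, j)\<in>I0. stress j x = elastic_limit cm cp \<alpha> j" for x
      proof (rule eq_of_stress_eq[OF x(1) vertex(1)])
        fix j assume "j \<in> snd ` I0"
        then obtain \<alpha> where "(\<alpha>, j) \<in> I0" by force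
        then show "stress j x = stress j ystar" using x(2) vertex(2) by fastforce
      qed
      then show ?thesis using vertex unfolding F spring_face_def by blast
    qed
    have sub: "spring_face I0 {} \<subseteq> elastic_set"
    proof -
      have "cm $ j \<le> stress j ystar \<and> stress j ystar \<le> cp $ j" for j
      proof (cases "j \<in> snd ` I0")
        case True
        then obtain \<alpha> where "(\<alpha>, j) \<in> I0" by force
        then have "stress j ystar = elastic_limit cm cp \<alpha> j" using vertex(2) by auto
        then show ?thesis using cmcp by (simp add: elastic_limit_def)
      next
        case False
        then show ?thesis using strict by (simp add: stress_def A_def less_imp_le)
      qed
      then show ?thesis using vertex(1) unfolding Feq[symmetric] F by (auto simp: elastic_set_def)
    qed
    have ne: "spring_face I0 {} \<noteq> {}" unfolding Feq[symmetric] F by simp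
    note attr = face_attraction[OF I0 injI _ _ gV g_rep[folded stress_def] irreducible(1) ne sub c' cL KL0,
        folded A_def Ceq Feq]
    show "\<exists>\<epsilon>>0. \<forall>\<tau>>0. AE t in lebesgue. t \<in> {0..\<tau>} \<longrightarrow>
           (\<exists>c'. (c has_vector_derivative c') (at t) \<and>
             (\<forall>y\<in>F. (\<lambda>x. - c' + x) ` (ball_A V A \<epsilon> \<inter> normal_cone_A V A F y) \<subseteq> normal_cone_A V A C y))"
      by (rule attr(1)) auto
    fix y assume "sweeping_solution V A Ct y"
    then have ev: "\<forall>\<^sub>F \<tau> in at_top. y \<tau> \<in> (\<lambda>x. x + c \<tau>) ` F"
      unfolding Ct_def by (intro attr(2)) auto
    then show "\<forall>\<^sub>F \<tau> in at_top. y \<tau> \<in> (\<lambda>x. x + c \<tau>) ` F" .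
    from ev show "\<forall>\<^sub>F \<tau> in at_top. A *v (y \<tau> - c \<tau>) = A *v ystar"
      by eventually_elim (auto simp: F)
  next

    \<comment> \<open>The case \<open>card I0 < d\<close>: attraction to a box\<close>
    fix I :: "nat \<Rightarrow> (real \<times> 'm) set" and M :: nat and ystar :: "nat \<Rightarrow> real^'m" and F
    assume "card I0 < d" and I1: "I 1 \<subseteq> {- 1, 1} \<times> UNIV" and card: "card I0 + card (I 1) = d"
      and dim: "dim ((*v) P ` face_vectors (I0 \<union> I 1)) = d" and "M = 2 ^ (d - card I0)"
      and bij: "bij_betw I {1..M} (sign_changes (I (1::nat)))"
      and F: "F = (\<Inter>(\<alpha>, j)\<in>I0. Lbar \<alpha> j) \<inter> (\<Inter>i\<in>{1..M}. \<Inter>(\<alpha>, j)\<in>I i. L \<alpha> j)"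
      and ystar: "\<forall>i\<in>{1..M}. ystar i = face_vertex V A cm cp (I0 \<union> I i)"
      and strict: "\<forall>i\<in>{1..M}. \<forall>j. j \<notin> snd ` (I0 \<union> (\<Union>i\<in>{1..M}. I i)) \<longrightarrow>
           cm $ j < axis j 1 \<bullet> (A *v ystar i) \<and> axis j 1 \<bullet> (A *v ystar i) < cp $ j"
    have finI1: "finite (I 1)" using I1 by (rule finite_subset) simp
    have finI: "finite (I0 \<union> I 1)" using finI0 finI1 by simp
    have cardI: "card (I0 \<union> I 1) \<le> CARD('k option)" using card_Un_le[of I0 "I 1"] card d by simp
    obtain w where "elastic_frame V a (snd ` (I0 \<union> I 1)) w" and injI: "inj_on snd (I0 \<union> I 1)"
      using elastic_frame_of_spanning_faces[OF a_pos V Vb(2) orth finI cardI] dim d by auto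
    then interpret elastic_frame V a cm cp "snd ` (I0 \<union> I 1)" w by simp
    have Ceq: "C = elastic_set" by (simp add: C_def elastic_set_def stress_def A_def)
    \<comment> \<open>Rank \<open>d\<close> leaves no room for an overlap of \<open>I0\<close> and
      \<open>I 1\<close>; with \<open>injI\<close> the two families then involve disjoint sets of
      springs.\<close>
    have "card (I0 \<union> I 1) = d"
    proof -
      have "d \<le> card (I0 \<union> I 1)"
        unfolding dim[symmetric] faces
        using dim_le_card'[of "(\<lambda>p. P *v f p) ` (I0 \<union> I 1)"] card_image_le[OF finI] finI
        by (meson finite_imageI le_trans)
      then show ?thesis using cardI d by simp
    qed
    then have "I0 \<inter> I 1 = {}"
      using card_Un_Int[OF finI0 finI1] card finI0 by auto
    then have disj: "snd ` I0 \<inter> snd ` I 1 = {}"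
      using inj_on_image_Int[OF injI, of I0 "I 1"] by simp
    have J: "snd ` (I0 \<union> I 1) = snd ` I0 \<union> snd ` I 1" by (rule image_Un)
    have families: "I ` {1..M} = sign_changes (I 1)" using bij by (simp add: bij_betw_def)
    have sndI: "snd ` I i = snd ` I 1" if "i \<in> {1..M}" for i
      using families that by (intro snd_sign_changes) auto
    have M: "1 \<in> {1..M}" using \<open>M = 2 ^ (d - card I0)\<close> by simp
    have sndU: "snd ` (I0 \<union> (\<Union>i\<in>{1..M}. I i)) = snd ` (I0 \<union> I 1)"
    proof -
      have "(\<Union>i\<in>{1..M}. snd ` I i) = (\<Union>i\<in>{1..M}. snd ` I 1)" by (rule SUP_cong[OF refl sndI])
      also have "\<dots> = snd ` I 1" using M by blast
      finally show ?thesis by (simp only: image_Un image_UN)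
    qed
    have Feq: "F = spring_face I0 (snd ` I 1)"
    proof -
      have "y \<in> (\<Inter>i\<in>{1..M}. \<Inter>(\<alpha>, j)\<in>I i. L \<alpha> j) \<longleftrightarrow>
          y \<in> V \<and> (\<forall>j\<in>snd ` I 1. cm $ j \<le> stress j y \<and> stress j y \<le> cp $ j)" (is "?l \<longleftrightarrow> ?r") for y
      proof
        assume ?r
        have "y \<in> L \<alpha> j" if i: "i \<in> {1..M}" "(\<alpha>, j) \<in> I i" for i \<alpha> j
        proof -
          have "j \<in> snd ` I 1" using sndI[OF i(1)] i(2) by force
          moreover have "\<alpha> = 1 \<or> \<alpha> = -1"
          proof -
            have "I i \<in> sign_changes (I 1)" using families i(1) by blast
            then show ?thesis using i(2) I1 by (fastforce simp: sign_changes_def)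
          qed
          ultimately show ?thesis
            using \<open>?r\<close> by (auto simp: L_def elastic_limit_def stress_def A_def)
        qed
        then show ?l by blast
      next
        assume l: ?l
        \<comment> \<open>Flipping a single element shows that each spring of \<open>I 1\<close>
          occurs with both signs among the families, so the half-spaces \<open>L\<close> impose both
          limits.\<close>
        have both: "\<exists>i\<in>{1..M}. (\<alpha>, j) \<in> I i" if j: "j \<in> snd ` I 1" and \<alpha>: "\<alpha> = 1 \<or> \<alpha> = -1" for \<alpha> j
        proof -
          obtain \<beta> where \<beta>: "(\<beta>, j) \<in> I 1" using j by force
          then have "\<beta> = \<alpha> \<or> \<beta> = - \<alpha>" using I1 \<alpha> by auto
          then show ?thesis
          proof
            assume "\<beta> = - \<alpha>"
            have "(I 1 - {(\<beta>, j)}) \<union> (\<lambda>(\<alpha>, j). (- \<alpha>, j)) ` {(\<beta>, j)} \<in> sign_changes (I 1)"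
              unfolding sign_changes_def using \<beta> by blast
            then obtain i where "i \<in> {1..M}" "I i = (I 1 - {(\<beta>, j)}) \<union> (\<lambda>(\<alpha>, j). (- \<alpha>, j)) ` {(\<beta>, j)}"
              using families by (metis (no_types, lifting) imageE)
            then show ?thesis using \<open>\<beta> = - \<alpha>\<close> by (intro bexI[of _ i]) auto
          qed (use \<beta> M in blast)
        qed
        have memL: "y \<in> L \<alpha> j" if "j \<in> snd ` I 1" "\<alpha> = 1 \<or> \<alpha> = -1" for \<alpha> j
          using l both[OF that] by blast
        \<comment> \<open>Membership in \<open>V\<close> is read off from one of the sets
          \<open>L\<close>, so at least one spring of \<open>I 1\<close> must exist;
          \<open>card I0 < d\<close> provides it.\<close>
        have "snd ` I 1 \<noteq> {}" using card \<open>card I0 < d\<close> by auto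
        then have "y \<in> V" using memL by (force simp: L_def)
        moreover have "cm $ j \<le> stress j y \<and> stress j y \<le> cp $ j" if "j \<in> snd ` I 1" for j
          using memL[OF that, of 1] memL[OF that, of "-1"]
          by (auto simp: L_def elastic_limit_def stress_def A_def)
        ultimately show ?r by blast
      qed
      note limits = this
      have active: "y \<in> (\<Inter>(\<alpha>, j)\<in>I0. Lbar \<alpha> j) \<longleftrightarrow> (\<forall>(\<alpha>, j)\<in>I0. stress j y = elastic_limit cm cp \<alpha> j)"
        if "y \<in> V" for y
        using that by (auto simp: Lbar_def stress_def A_def)
      show ?thesis
      proof (rule set_eqI)
        show "y \<in> F \<longleftrightarrow> y \<in> spring_face I0 (snd ` I 1)" for y
          unfolding F Int_iff limits spring_face_def mem_Collect_eq using active[of y] by blast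
      qed
    qed
    have hull: "F \<subseteq> convex hull (ystar ` {1..M})"
    proof -
      have "(\<lambda>I. face_vertex V (diag_matrix a) cm cp (I0 \<union> I)) ` sign_changes (I 1) = ystar ` {1..M}"
        using ystar unfolding families[symmetric] image_image A_def by (intro image_cong) auto
      then show ?thesis using spring_face_subset_convex_hull[OF I0 I1 J disj] Feq by simp
    qed
    have ne: "spring_face I0 (snd ` I 1) \<noteq> {}"
    proof -
      note vertex = face_vertex_exists[OF refl injI]
      have "cm $ j \<le> stress j (face_vertex V (diag_matrix a) cm cp (I0 \<union> I 1)) \<and>
          stress j (face_vertex V (diag_matrix a) cm cp (I0 \<union> I 1)) \<le> cp $ j" if j: "j \<in> snd ` I 1" for j
      proof -
        obtain \<alpha> where \<alpha>: "(\<alpha>, j) \<in> I0 \<union> I 1" using j by force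
        show ?thesis using bspec[OF vertex(2) \<alpha>] cmcp by (simp add: elastic_limit_def)
      qed
      then have "face_vertex V (diag_matrix a) cm cp (I0 \<union> I 1) \<in> spring_face I0 (snd ` I 1)"
        using vertex by (auto simp: spring_face_def)
      then show ?thesis by blast
    qed
    have sub: "spring_face I0 (snd ` I 1) \<subseteq> elastic_set"
    proof
      fix y assume y: "y \<in> spring_face I0 (snd ` I 1)"
      have "cm $ j \<le> stress j y \<and> stress j y \<le> cp $ j" for j
      proof (cases "j \<in> snd ` (I0 \<union> I 1)")
        case True
        show ?thesis
        proof (cases "j \<in> snd ` I 1")
          case True
          then show ?thesis using y by (auto simp: spring_face_def)
        next
          case False
          then obtain \<alpha> where "(\<alpha>, j) \<in> I0" using True by force
          then have "stress j y = elastic_limit cm cp \<alpha> j" using y by (auto simp: spring_face_def)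
          then show ?thesis using cmcp by (simp add: elastic_limit_def)
        qed
      next
        case False
        \<comment> \<open>For a spring outside both families the limits hold at all vertices by
          assumption, and pass to their convex hull because the stress is linear.\<close>
        have "convex hull (ystar ` {1..M}) \<subseteq> stress j -` {cm $ j..cp $ j}"
        proof (rule hull_minimal)
          show "convex (stress j -` {cm $ j..cp $ j})"
            by (intro convex_linear_vimage linear_stress) simp
        qed (use False strict sndU in \<open>auto simp: stress_def A_def less_imp_le\<close>)
        then show ?thesis using hull y Feq by auto
      qed
      then show "y \<in> elastic_set" using y by (auto simp: elastic_set_def spring_face_def)
    qed
    note attr = face_attraction[OF I0 inj_on_subset[OF injI Un_upper1] J disj gV g_rep[folded stress_def]
        irreducible(1) ne sub c' cL KL0, folded A_def Ceq Feq]
    show "\<exists>\<epsilon>>0. \<forall>\<tau>>0. AE t in lebesgue. t \<in> {0..\<tau>} \<longrightarrow>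
           (\<exists>c'. (c has_vector_derivative c') (at t) \<and>
             (\<forall>y\<in>F. (\<lambda>x. - c' + x) ` (ball_A V A \<epsilon> \<inter> normal_cone_A V A F y) \<subseteq> normal_cone_A V A C y))"
      by (rule attr(1)) auto
    fix y assume "sweeping_solution V A Ct y"
    then have ev: "\<forall>\<^sub>F \<tau> in at_top. y \<tau> \<in> (\<lambda>x. x + c \<tau>) ` F"
      unfolding Ct_def by (intro attr(2)) auto
    then show "\<forall>\<^sub>F \<tau> in at_top. y \<tau> \<in> (\<lambda>x. x + c \<tau>) ` F" .
    \<comment> \<open>Convex hulls commute with the linear map \<open>A\<close>, so the bound on
      \<open>y \<tau> - c \<tau>\<close> becomes one on the stress vector.\<close>
    have "convex hull ((\<lambda>i. A *v ystar i) ` {1..M}) = (*v) A ` (convex hull (ystar ` {1..M}))"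
      by (simp add: convex_hull_linear_image[OF matrix_vector_mul_linear] image_image)
    with ev show "\<forall>\<^sub>F \<tau> in at_top. A *v (y \<tau> - c \<tau>) \<in> convex hull ((\<lambda>i. A *v ystar i) ` {1..M})"
      using hull by (elim eventually_mono) auto
  qed
qed

end
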